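(* In the setting described in the context, for every $p\in\{0,\dots,n\}$, $$L_p^N\xrightarrow[N\to\infty]{\text{a.s.}}L_p .$$ Moreover, for every $p\in\{0,\dots,n\}$ and every $f\in L^2(\eta)$, $\eta_p^N(f)\to\eta_p(f)$ in probability as $N\to\infty$, and for every bounded measurable $f:\mathbb{R}^d\to\mathbb{R}$, $\eta_p^N(f)\to\eta_p(f)$ almost surely as $N\to\infty$.
   Context: Let $d\ge1$ and let $\eta$ be a probability measure on $\mathbb{R}^d$ having a density with respect to Lebesgue measure (also denoted $\eta(x)$). Let $S:\mathbb{R}^d\to\mathbb{R}$ be Lipschitz with $|DS|>0$ almost everywhere ($|DS|$ is the Euclidean norm of the gradient). For $X\sim\eta$, $Y=S(X)$ has density $f_Y(s)=\int_{\{S(x)=s\}}\eta(x)\,\frac{\mathcal{H}^{d-1}(dx)}{|DS(x)|}$ ($\mathcal H^{d-1}$ the Hausdorff measure on the level set) and cdf $F_Y$. Fix $L^\star\in\mathbb{R}$ with $P:=\mathbb{P}(Y\ge L^\star)>0$ and $\alpha\in(0,1)$; let $n=\lfloor \log P/\log\alpha\rfloor$ and $r=P\alpha^{-n}$, and assume $r\in(\alpha,1)$. Set $L_{-1}=-\infty$ and $L_p=F_Y^{-1}(1-\alpha^{p+1})$ for $0\le p\le n$ (so $L_{n-1}<L^\star<L_n$). Assume $f_Y$ is continuous and strictly positive at each $L_p$, $0\le p\le n$. For $L\in\mathbb{R}$ let $\mathcal A_L=\{x:S(x)\ge L\}$, $G_L=\mathbf 1_{\mathcal A_L}$, and $G_p=G_{L_p}$.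 Define $\eta_p(dx)=\alpha^{-p}G_{p-1}(x)\eta(x)\,dx$ (so $\eta_0=\eta$). For each $p\ge1$, $K_p$ is a Markov kernel on $\mathbb{R}^d$ reversible with respect to $\eta$: $\eta(dx)K_p(x,dx')=\eta(dx')K_p(x',dx)$. For $L\in\mathbb{R}$, define $M_{p,L}(x,dx')=K_p(x,dx')\mathbf 1_{\mathcal A_L}(x')+K_p(x,\mathbb{R}^d\setminus\mathcal A_L)\delta_x(dx')$ if $x\in\mathcal A_L$, and $M_{p,L}(x,\cdot)=\delta_x$ if $x\notin\mathcal A_L$. Adaptive multilevel splitting with $N$ particles: every particle carries an independent Uniform$(0,1)$ mark $u$, and couples are totally ordered by $(x,u)<(x',u')$ iff $S(x)<S(x')$, or $S(x)=S(x')$ and $u<u'$. The empirical $(1-\alpha)$-quantile of a marked sample of size $N$ is the couple of rank $\lfloor N(1-\alpha)\rfloor$ in this order; exactly $\lceil N\alpha\rceil$ couples are strictly above it; when used as a real number it means its $S$-value. Start with $X_0^1,\dots,X_0^N$ i.i.d. with law $\eta$. For $p\ge0$: let $L_p^N$ be the empirical $(1-\alpha)$-quantile of the marked sample $(X_p^i)_i$; draw $X_{p+1/2}^1,\dots,X_{p+1/2}^N$ i.i.d. uniformly from the $\lceil N\alpha\rceil$ particles $X_p^i$ strictly above $L_p^N$; then, independently for each $i$, draw $X_{p+1}^i\sim M_{p+1,L_p^N}(X_{p+1/2}^i,\cdot)$ (with fresh marks). Let $\eta_p^N=\frac1N\sum_{i=1}^N\delta_{X_p^i}$. (The practical algorithm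 stops at the first $p$ with $L_p^N\ge L^\star$.) *)

theory Defs
  imports "HOL-Probability.Probability"
begin

definition etaM :: "('a::euclidean_space \<Rightarrow> real) \<Rightarrow> 'a measure" where
  "etaM \<eta> = density lborel (\<lambda>x. ennreal (\<eta> x))"

definition cdfY :: "('a::euclidean_space \<Rightarrow> real) \<Rightarrow> ('a \<Rightarrow> real) \<Rightarrow> real \<Rightarrow> real" where
  "cdfY \<eta> S s = measure (etaM \<eta>) {x. S x \<le> s}"

definition Lq :: "('a::euclidean_space \<Rightarrow> real) \<Rightarrow> ('a \<Rightarrow> real) \<Rightarrow> real \<Rightarrow> nat \<Rightarrow> real" where
  "Lq \<eta> S \<alpha> p = Inf {s. 1 - \<alpha> ^ Suc p \<le> cdfY \<eta> S s}"

text \<open>eta_p(f) = alpha^(-p) * integral of G_(p-1) f eta, with G_(-1) = 1\<close>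
definition etap :: "('a::euclidean_space \<Rightarrow> real) \<Rightarrow> ('a \<Rightarrow> real) \<Rightarrow> real \<Rightarrow> nat \<Rightarrow> ('a \<Rightarrow> real) \<Rightarrow> real" where
  "etap \<eta> S \<alpha> p f =
     (if p = 0 then (\<integral>x. f x \<partial>etaM \<eta>)
      else (1 / \<alpha> ^ p) * (\<integral>x. indicator {x. Lq \<eta> S \<alpha> (p - 1) \<le> S x} x * f x \<partial>etaM \<eta>))"

definition cless :: "('a \<Rightarrow> real) \<Rightarrow> 'a \<times> real \<Rightarrow> 'a \<times> real \<Rightarrow> bool" where
  "cless S a b \<longleftrightarrow> S (fst a) < S (fst b) \<or> (S (fst a) = S (fst b) \<and> snd a < snd b)"

definition qrank :: "real \<Rightarrow> nat \<Rightarrow> nat" where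
  "qrank \<alpha> N = nat \<lfloor>real N * (1 - \<alpha>)\<rfloor>"

text \<open>index of the couple of rank qrank (1-indexed) among c 0, ..., c (N-1)\<close>
definition qidx :: "('a \<Rightarrow> real) \<Rightarrow> real \<Rightarrow> nat \<Rightarrow> (nat \<Rightarrow> 'a \<times> real) \<Rightarrow> nat" where
  "qidx S \<alpha> N c = (SOME j. j < N
      \<and> card {i. i < N \<and> cless S (c i) (c j)} = qrank \<alpha> N - 1
      \<and> card {i. i < N \<and> cless S (c j) (c i)} = N - qrank \<alpha> N)"

definition qlev :: "('a \<Rightarrow> real) \<Rightarrow> real \<Rightarrow> nat \<Rightarrow> (nat \<Rightarrow> 'a \<times> real) \<Rightarrow> real" where
  "qlev S \<alpha> N c = S (fst (c (qidx S \<alpha> N c)))"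

definition surv :: "('a \<Rightarrow> real) \<Rightarrow> real \<Rightarrow> nat \<Rightarrow> (nat \<Rightarrow> 'a \<times> real) \<Rightarrow> nat set" where
  "surv S \<alpha> N c = {i. i < N \<and> cless S (c (qidx S \<alpha> N c)) (c i)}"

definition emp :: "nat \<Rightarrow> (nat \<Rightarrow> 'a \<times> real) \<Rightarrow> ('a \<Rightarrow> real) \<Rightarrow> real" where
  "emp N c f = (\<Sum>i<N. f (fst (c i))) / real N"

definition Mker :: "('a::euclidean_space \<Rightarrow> real) \<Rightarrow> (nat \<Rightarrow> 'a \<Rightarrow> 'a measure) \<Rightarrow> nat \<Rightarrow> real \<Rightarrow> 'a \<Rightarrow> 'a measure" where
  "Mker S K p L x =
     (if L \<le> S x then distr (K p x) borel (\<lambda>y. if L \<le> S y then y else x)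
      else return borel x)"

definition mark :: "real measure" where
  "mark = uniform_measure lborel {0..1}"

definition CM :: "nat \<Rightarrow> (nat \<Rightarrow> 'a::euclidean_space \<times> real) measure" where
  "CM N = PiM {..<N} (\<lambda>_. (borel :: 'a measure) \<Otimes>\<^sub>M (borel :: real measure))"

definition partM :: "('a::euclidean_space \<Rightarrow> real) \<Rightarrow> (nat \<Rightarrow> 'a \<Rightarrow> 'a measure) \<Rightarrow> real \<Rightarrow> nat \<Rightarrow> nat
    \<Rightarrow> (nat \<Rightarrow> 'a \<times> real) \<Rightarrow> nat \<Rightarrow> ('a \<times> real) measure" where
  "partM S K \<alpha> N p c i =
     (if surv S \<alpha> N c = {} then return (borel \<Otimes>\<^sub>M borel) (c i)
      else bind (uniform_count_measure (surv S \<alpha> N c))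
             (\<lambda>j. Mker S K (Suc p) (qlev S \<alpha> N c) (fst (c j)) \<Otimes>\<^sub>M mark))"

definition stepM :: "('a::euclidean_space \<Rightarrow> real) \<Rightarrow> (nat \<Rightarrow> 'a \<Rightarrow> 'a measure) \<Rightarrow> real \<Rightarrow> nat \<Rightarrow> nat
    \<Rightarrow> (nat \<Rightarrow> 'a \<times> real) \<Rightarrow> (nat \<Rightarrow> 'a \<times> real) measure" where
  "stepM S K \<alpha> N p c = PiM {..<N} (\<lambda>i. partM S K \<alpha> N p c i)"

text \<open>law of generations 0..k of the N-particle algorithm (omega p i = (X_p^i, mark))\<close>
primrec traj :: "('a::euclidean_space \<Rightarrow> real) \<Rightarrow> ('a \<Rightarrow> real) \<Rightarrow> (nat \<Rightarrow> 'a \<Rightarrow> 'a measure) \<Rightarrow> real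
    \<Rightarrow> nat \<Rightarrow> nat \<Rightarrow> (nat \<Rightarrow> nat \<Rightarrow> 'a \<times> real) measure" where
  "traj \<eta> S K \<alpha> N 0 =
     distr (PiM {..<N} (\<lambda>_. etaM \<eta> \<Otimes>\<^sub>M mark)) (PiM {..0} (\<lambda>_. CM N)) (\<lambda>c. \<lambda>k\<in>{..0}. c)"
| "traj \<eta> S K \<alpha> N (Suc k) =
     bind (traj \<eta> S K \<alpha> N k)
       (\<lambda>\<omega>. distr (stepM S K \<alpha> N k (\<omega> k)) (PiM {..Suc k} (\<lambda>_. CM N)) (\<lambda>c. fun_upd \<omega> (Suc k) c))"

end

theory Submission
  imports Defs
begin

text \<open>
  Given generation \<open>p\<close>, the particles of generation \<open>p + 1\<close> are i.i.d., so Hoeffding's inequality and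
  Borel--Cantelli reduce the law of large numbers for bounded \<open>f\<close> to the convergence of the conditional
  mean, an average of \<open>M\<^bsub>p+1,L\<^esub> f\<close> over the survivors with the random level \<open>L = L\<^sub>p\<^sup>N\<close>. Moving the level
  by at most \<open>d\<close> around \<open>L\<^sub>p\<close> changes this average by at most the empirical mean of
  \<open>2 \<bar>f\<bar>\<^sub>\<infinity> (1{\<bar>S - L\<^sub>p\<bar> \<le> d} + K(\<cdot>, {\<bar>S - L\<^sub>p\<bar> \<le> d}))\<close>, a bounded function to which the law of large
  numbers for generation \<open>p\<close> applies and whose \<open>\<eta>\<close>-integral is small because \<open>\<eta> K = \<eta>\<close> and \<open>Y\<close> has no
  atoms. At the fixed level \<open>L\<^sub>p\<close>, reversibility makes \<open>\<eta>\<close> restricted to \<open>{S \<ge> L\<^sub>p}\<close> invariant. The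
  quantiles converge because \<open>Y\<close> has positive mass on both sides of \<open>L\<^sub>p\<close>.

  For unbounded \<open>f\<close>, the bound \<open>M\<^bsub>p,L\<^esub> h \<le> K\<^sub>p h + h\<close> for \<open>h \<ge> 0\<close> gives
  \<open>E \<eta>\<^sub>p\<^sup>N(h) \<le> (2/\<alpha>)\<^sup>p \<eta>(h)\<close> uniformly in \<open>N\<close>, so \<open>f\<close> can be truncated.
\<close>

section \<open>Empirical quantiles\<close>

text \<open>Almost sure convergence puts all \<open>N\<close> on one space, but only the law of each
  single run is known, not how runs for different \<open>N\<close> are coupled. Borel--Cantelli must
  thus work from bounds on each run that are summable in \<open>N\<close>: an exponential rate is,
  the variance rate 1/N is not. The main obstacle is that the level and the survivor set depend on
  the whole generation, so the function averaged over the survivors is random and no law of large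
  numbers applies to it directly. It is compared with test functions at the deterministic level, the
  error being dominated by fixed functions with d = 1/(k+1); countably many of them keep the union
  of exceptional sets null. The statements feed each other: the law of large numbers at one
  generation, for all bounded test functions, gives the quantile there, and both give the next
  generation. Truncation of unbounded functions yields convergence in probability only: the bound on
  the tail term is small for a high truncation level but does not decay in \<open>N\<close>. Ranks
  make sense only when the marks are distinct and the rank is positive, so every step is restricted
  to almost all outcomes and to large \<open>N\<close>.\<close>

lemma qrank_le: "0 < \<alpha> \<Longrightarrow> qrank \<alpha> N \<le> N"
proof -
  assume "0 < \<alpha>"
  then have "real N * (1 - \<alpha>) \<le> real N" by (simp add: algebra_simps)
  then have "\<lfloor>real N * (1 - \<alpha>)\<rfloor> \<le> int N" by (metis floor_mono floor_of_nat)
  then show ?thesis unfolding qrank_def by simp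
qed

lemma qrank_bounds:
  assumes "0 < \<alpha>" "\<alpha> < 1"
  shows "real (qrank \<alpha> N) \<le> real N * (1 - \<alpha>)" "real N * (1 - \<alpha>) - 1 < real (qrank \<alpha> N)"
proof -
  have "0 \<le> \<lfloor>real N * (1 - \<alpha>)\<rfloor>" using assms by simp
  then have "real (qrank \<alpha> N) = of_int \<lfloor>real N * (1 - \<alpha>)\<rfloor>" unfolding qrank_def by simp
  then show "real (qrank \<alpha> N) \<le> real N * (1 - \<alpha>)" "real N * (1 - \<alpha>) - 1 < real (qrank \<alpha> N)"
    by linarith+
qed

text \<open>For small \<open>N\<close> the rank can be 0, which no couple has, and
  \<open>qidx\<close> is then an arbitrary value. Asymptotic statements are made beyond that
  range.\<close>

lemma eventually_qrank_ge_1: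
  assumes "0 < \<alpha>" "\<alpha> < 1"
  shows "eventually (\<lambda>N. 1 \<le> qrank \<alpha> N) sequentially"
proof -
  obtain N0 where N0: "2 / (1 - \<alpha>) < real N0" using reals_Archimedean2 by blast
  show ?thesis
  proof (rule eventually_sequentiallyI[of N0])
    fix N assume "N0 \<le> N"
    with N0 have "2 / (1 - \<alpha>) < real N" by linarith
    then have "2 < real N * (1 - \<alpha>)" using assms by (simp add: field_simps)
    with qrank_bounds(2)[OF assms, of N] show "1 \<le> qrank \<alpha> N" by linarith
  qed
qed

lemma cless_trans: "cless S a b \<Longrightarrow> cless S b c \<Longrightarrow> cless S a c"
  unfolding cless_def by auto

lemma cless_irrefl: "\<not> cless S a a"
  unfolding cless_def by auto

lemma cless_total: "snd a \<noteq> snd b \<Longrightarrow> cless S a b \<or> cless S b a"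
  unfolding cless_def by auto

text \<open>Distinct marks make \<open>cless\<close> a strict total order on the indices, so the
  number of predecessors is strictly increasing along it. As an injective map of {0, ..., N-1} into
  itself it is onto, and every rank is attained.\<close>

lemma qidx_correct:
  assumes inj: "inj_on (\<lambda>i. snd (c i)) {..<N}" and q: "1 \<le> qrank \<alpha> N" "qrank \<alpha> N \<le> N"
  shows "qidx S \<alpha> N c < N"
    and "card {i. i < N \<and> cless S (c i) (c (qidx S \<alpha> N c))} = qrank \<alpha> N - 1"
    and "card {i. i < N \<and> cless S (c (qidx S \<alpha> N c)) (c i)} = N - qrank \<alpha> N"
proof -
  define B where "B j = {i. i < N \<and> cless S (c i) (c j)}" for j
  define A where "A j = {i. i < N \<and> cless S (c j) (c i)}" for j
  have tot: "cless S (c i) (c j) \<or> cless S (c j) (c i)" if "i < N" "j < N" "i \<noteq> j" for i j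
    using cless_total[of "c i" "c j" S] inj that by (auto simp: inj_on_def)
  have mono: "card (B i) < card (B j)" if "i < N" "cless S (c i) (c j)" for i j
  proof (rule psubset_card_mono)
    show "finite (B j)" unfolding B_def by auto
    have "i \<in> B j" "i \<notin> B i" using that cless_irrefl[of S "c i"] unfolding B_def by auto
    moreover have "B i \<subseteq> B j" using that cless_trans unfolding B_def by blast
    ultimately show "B i \<subset> B j" by auto
  qed
  have "inj_on (\<lambda>j. card (B j)) {..<N}"
  proof (rule inj_onI, rule ccontr)
    fix i j assume "i \<in> {..<N}" "j \<in> {..<N}" "card (B i) = card (B j)" "i \<noteq> j"
    then show False using tot[of i j] mono[of i j] mono[of j i] by auto
  qed
  moreover have "(\<lambda>j. card (B j)) ` {..<N} \<subseteq> {..<N}"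
  proof safe
    fix j assume "j < N"
    then have "B j \<subset> {..<N}" using cless_irrefl[of S "c j"] unfolding B_def by auto
    then show "card (B j) < N" using psubset_card_mono[of "{..<N}" "B j"] by simp
  qed
  ultimately have "(\<lambda>j. card (B j)) ` {..<N} = {..<N}"
    by (simp add: endo_inj_surj)
  moreover have "qrank \<alpha> N - 1 \<in> {..<N}" using q by auto
  ultimately obtain j where j: "j < N" "card (B j) = qrank \<alpha> N - 1" by (metis (no_types, lifting) imageE lessThan_iff)
  \<comment> \<open>Predecessors, successors and \<open>j\<close> itself partition the indices, so
    the count below fixes the count above.\<close>
  have "{..<N} = insert j (B j \<union> A j)" using tot j unfolding A_def B_def by auto
  moreover have "B j \<inter> A j = {}" using cless_trans cless_irrefl unfolding A_def B_def by blast
  moreover have "j \<notin> B j \<union> A j" using cless_irrefl[of S "c j"] unfolding A_def B_def by auto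
  moreover have "finite (B j)" "finite (A j)" unfolding A_def B_def by auto
  ultimately have "N = Suc (card (B j) + card (A j))"
    by (metis card_Un_disjoint card_insert_disjoint card_lessThan finite_UnI)
  then have "card (A j) = N - qrank \<alpha> N" using j q by simp
  then have "\<exists>j. j < N \<and> card {i. i < N \<and> cless S (c i) (c j)} = qrank \<alpha> N - 1
      \<and> card {i. i < N \<and> cless S (c j) (c i)} = N - qrank \<alpha> N"
    using j unfolding A_def B_def by blast
  from someI_ex[OF this] show "qidx S \<alpha> N c < N"
    "card {i. i < N \<and> cless S (c i) (c (qidx S \<alpha> N c))} = qrank \<alpha> N - 1"
    "card {i. i < N \<and> cless S (c (qidx S \<alpha> N c)) (c i)} = N - qrank \<alpha> N"
    unfolding qidx_def by blast+
qed

lemma surv_subset: "surv S \<alpha> N c \<subseteq> {..<N}"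
  unfolding surv_def by auto

lemma card_surv:
  assumes "inj_on (\<lambda>i. snd (c i)) {..<N}" "1 \<le> qrank \<alpha> N" "0 < \<alpha>"
  shows "card (surv S \<alpha> N c) = N - qrank \<alpha> N"
  using qidx_correct(3)[OF assms(1,2) qrank_le[OF assms(3)]] unfolding surv_def .

text \<open>\<open>N\<close> minus a floor of N(1-\<alpha>) is at least N\<alpha>. This caps the
  probability of choosing any given parent by 1/(N\<alpha>).\<close>

lemma card_surv_ge:
  assumes "inj_on (\<lambda>i. snd (c i)) {..<N}" "1 \<le> qrank \<alpha> N" "0 < \<alpha>" "\<alpha> < 1"
  shows "real N * \<alpha> \<le> real (card (surv S \<alpha> N c))"
    and "surv S \<alpha> N c \<noteq> {}"
proof -
  have "real (card (surv S \<alpha> N c)) = real N - real (qrank \<alpha> N)"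
    using card_surv[OF assms(1-3)] qrank_le[OF assms(3), of N] by (simp add: of_nat_diff)
  then show *: "real N * \<alpha> \<le> real (card (surv S \<alpha> N c))"
    using qrank_bounds(1)[OF assms(3,4), of N] by (simp add: algebra_simps)
  have "0 < real N * \<alpha>" using assms(2,3) qrank_le[OF assms(3), of N] by simp
  with * show "surv S \<alpha> N c \<noteq> {}" by (intro notI) simp
qed

text \<open>The two inclusions do not meet: a particle with exactly the quantile score survives or
  dies according to its mark. The gap later falls into a thin band around the level.\<close>

lemma surv_level:
  "S (fst (c i)) > qlev S \<alpha> N c \<Longrightarrow> i < N \<Longrightarrow> i \<in> surv S \<alpha> N c"
  "i \<in> surv S \<alpha> N c \<Longrightarrow> qlev S \<alpha> N c \<le> S (fst (c i))"
  unfolding surv_def qlev_def cless_def by auto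

lemma emp_indicator: "emp N c (indicator A) = real (card {i. i < N \<and> fst (c i) \<in> A}) / real N"
proof -
  have "(\<Sum>i<N. indicator A (fst (c i)) :: real) = (\<Sum>i\<in>{i. i < N \<and> fst (c i) \<in> A}. 1)"
    by (intro sum.mono_neutral_cong_right) auto
  then show ?thesis unfolding emp_def by simp
qed

text \<open>If the quantile were at most \<open>s\<close>, its couple and all predecessors,
  \<open>qrank \<alpha> N\<close> in number, would have score at most \<open>s\<close>. The slack
  1/N pays for the rounding in the rank, which exceeds N(1-\<alpha>) - 1; the companion upper bound
  needs no slack because a floor rounds down.\<close>

lemma qlev_gt:
  assumes inj: "inj_on (\<lambda>i. snd (c i)) {..<N}" and q: "1 \<le> qrank \<alpha> N" and \<alpha>: "0 < \<alpha>" "\<alpha> < 1"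
    and emp: "emp N c (indicator {x. S x \<le> s}) \<le> 1 - \<alpha> - 1 / real N"
  shows "s < qlev S \<alpha> N c"
proof (rule ccontr)
  assume "\<not> s < qlev S \<alpha> N c"
  then have le: "S (fst (c (qidx S \<alpha> N c))) \<le> s" unfolding qlev_def by simp
  note Q = qidx_correct[OF inj q qrank_le[OF \<alpha>(1)], where S=S]
  have N: "0 < N" using Q(1) by simp
  let ?q = "qidx S \<alpha> N c"
  have "card (insert ?q {i. i < N \<and> cless S (c i) (c ?q)}) \<le> card {i. i < N \<and> fst (c i) \<in> {x. S x \<le> s}}"
    using le Q(1) by (intro card_mono) (auto simp: cless_def)
  also have "card (insert ?q {i. i < N \<and> cless S (c i) (c ?q)}) = qrank \<alpha> N"
    using Q(2) q cless_irrefl[of S "c ?q"] by simp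
  finally have "real (qrank \<alpha> N) / N \<le> emp N c (indicator {x. S x \<le> s})"
    unfolding emp_indicator by (simp add: divide_right_mono)
  with emp have "real (qrank \<alpha> N) / N \<le> 1 - \<alpha> - 1 / real N" by simp
  then have "real (qrank \<alpha> N) \<le> real N * (1 - \<alpha>) - 1" using N by (simp add: field_simps)
  with qrank_bounds(2)[OF \<alpha>, of N] show False by simp
qed

lemma qlev_le:
  assumes inj: "inj_on (\<lambda>i. snd (c i)) {..<N}" and q: "1 \<le> qrank \<alpha> N" and \<alpha>: "0 < \<alpha>" "\<alpha> < 1"
    and emp: "1 - \<alpha> < emp N c (indicator {x. S x \<le> s})"
  shows "qlev S \<alpha> N c \<le> s"
proof (rule ccontr)
  assume "\<not> qlev S \<alpha> N c \<le> s"
  then have le: "s < S (fst (c (qidx S \<alpha> N c)))" unfolding qlev_def by simp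
  note Q = qidx_correct[OF inj q qrank_le[OF \<alpha>(1)], where S=S]
  have N: "0 < N" using Q(1) by simp
  let ?q = "qidx S \<alpha> N c"
  have "card {i. i < N \<and> fst (c i) \<in> {x. S x \<le> s}} \<le> card {i. i < N \<and> cless S (c i) (c ?q)}"
    using le by (intro card_mono) (auto simp: cless_def)
  then have "emp N c (indicator {x. S x \<le> s}) \<le> real (qrank \<alpha> N) / N"
    unfolding emp_indicator using Q(2) by (intro divide_right_mono) auto
  also have "\<dots> \<le> 1 - \<alpha>" using qrank_bounds(1)[OF \<alpha>, of N] N by (simp add: field_simps)
  finally show False using emp by simp
qed

text \<open>A statement about one realization. The thresholds form a countable family so that their
  limits can later be required simultaneously, almost surely.\<close>

lemma qlev_tendsto:
  assumes inj: "eventually (\<lambda>N. inj_on (\<lambda>i. snd (c N i)) {..<N}) sequentially"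
    and \<alpha>: "0 < \<alpha>" "\<alpha> < 1"
    and below: "\<And>k::nat. (\<lambda>N. emp N (c N) (indicator {x. S x \<le> l - 1 / Suc k})) \<longlonglongrightarrow> a k" "\<And>k. a k < 1 - \<alpha>"
    and above: "\<And>k::nat. (\<lambda>N. emp N (c N) (indicator {x. S x \<le> l + 1 / Suc k})) \<longlonglongrightarrow> b k" "\<And>k. 1 - \<alpha> < b k"
  shows "(\<lambda>N. qlev S \<alpha> N (c N)) \<longlonglongrightarrow> l"
proof (rule LIMSEQ_I)
  fix e :: real assume "0 < e"
  then obtain k :: nat where k: "1 / Suc k < e" using nat_approx_posE by blast
  have "(\<lambda>N. emp N (c N) (indicator {x. S x \<le> l - 1 / Suc k}) + 1 / real N) \<longlonglongrightarrow> a k + 0"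
    by (intro tendsto_add below lim_1_over_n)
  then have "eventually (\<lambda>N. emp N (c N) (indicator {x. S x \<le> l - 1 / Suc k}) + 1 / real N < 1 - \<alpha>) sequentially"
    using below(2)[of k] by (intro order_tendstoD(2)) auto
  moreover have "eventually (\<lambda>N. 1 - \<alpha> < emp N (c N) (indicator {x. S x \<le> l + 1 / Suc k})) sequentially"
    using above by (intro order_tendstoD(1)) auto
  ultimately have "eventually (\<lambda>N. norm (qlev S \<alpha> N (c N) - l) < e) sequentially"
    using inj eventually_qrank_ge_1[OF \<alpha>]
  proof eventually_elim
    case (elim N)
    have "l - 1 / Suc k < qlev S \<alpha> N (c N)" using elim by (intro qlev_gt \<alpha>) auto
    moreover have "qlev S \<alpha> N (c N) \<le> l + 1 / Suc k" using elim by (intro qlev_le \<alpha>) auto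
    ultimately show ?case using k by auto
  qed
  then show "\<exists>no. \<forall>N\<ge>no. norm (qlev S \<alpha> N (c N) - l) < e"
    by (simp add: eventually_sequentially)
qed

section \<open>Measurability of the transition kernels\<close>

text \<open>The choice depends on \<open>x\<close> only through the set of admissible indices, a
  subset of {0, ..., N-1}. That set is a measurable function into a finite discrete space, on which
  every map, including the choice, is measurable.\<close>

lemma measurable_Eps_nat:
  assumes P: "\<And>j. Measurable.pred M (P j)" and N: "\<And>j x. P j x \<Longrightarrow> j < (N::nat)"
  shows "(\<lambda>x. SOME j. P j x) \<in> M \<rightarrow>\<^sub>M count_space UNIV"
proof -
  have "(\<lambda>x. {j. P j x}) \<in> M \<rightarrow>\<^sub>M count_space (Pow {..<N})"
  proof (subst measurable_count_space_eq2, safe)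
    fix A assume A: "A \<subseteq> {..<N}"
    have "(\<lambda>x. {j. P j x}) -` {A} \<inter> space M = {x \<in> space M. \<forall>j\<in>{..<N}. P j x \<longleftrightarrow> j \<in> A}"
      using N A by (auto 0 4)
    also have "\<dots> \<in> sets M" using P by measurable
    finally show "(\<lambda>x. {j. P j x}) -` {A} \<inter> space M \<in> sets M" .
  qed (use N in auto)
  moreover have "(\<lambda>A. SOME j. j \<in> A) \<in> count_space (Pow {..<N}) \<rightarrow>\<^sub>M count_space UNIV" by simp
  ultimately have "(\<lambda>x. SOME j. j \<in> {j. P j x}) \<in> M \<rightarrow>\<^sub>M count_space UNIV"
    by (rule measurable_compose)
  then show ?thesis by simp
qed

text \<open>Boxes form an intersection-stable generator, and on a box the product measure is a
  finite product of measurable functions of \<open>x\<close>.\<close>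

lemma PiM_prob_kernel:
  assumes I: "finite I"
    and k: "\<And>i. i \<in> I \<Longrightarrow> k i \<in> M \<rightarrow>\<^sub>M subprob_algebra (N i)"
    and p: "\<And>i x. x \<in> space M \<Longrightarrow> prob_space (k i x)"
  shows "(\<lambda>x. PiM I (\<lambda>i. k i x)) \<in> M \<rightarrow>\<^sub>M prob_algebra (PiM I N)"
proof (rule measurable_prob_algebraI)
  show "prob_space (PiM I (\<lambda>i. k i x))" if "x \<in> space M" for x
    using p[OF that] by (intro prob_space_PiM) 
  have sets: "sets (PiM I (\<lambda>i. k i x)) = sets (PiM I N)" if "x \<in> space M" for x
    using sets_kernel[OF k that] by (intro sets_PiM_cong) auto
  show "(\<lambda>x. PiM I (\<lambda>i. k i x)) \<in> M \<rightarrow>\<^sub>M subprob_algebra (PiM I N)"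
  proof (rule measurable_subprob_algebra_generated[OF sets_PiM Int_stable_prod_algebra prod_algebra_sets_into_space])
    fix x assume x: "x \<in> space M"
    show "subprob_space (PiM I (\<lambda>i. k i x))"
      using p[OF x] by (intro prob_space_imp_subprob_space prob_space_PiM)
    show "sets (PiM I (\<lambda>i. k i x)) = sets (PiM I N)" using sets[OF x] .
  next
    have box: "(\<lambda>x. emeasure (PiM I (\<lambda>i. k i x)) (Pi\<^sub>E I X)) \<in> borel_measurable M"
      if X: "X \<in> (\<Pi> j\<in>I. sets (N j))" for X
    proof -
      have "emeasure (PiM I (\<lambda>i. k i x)) (Pi\<^sub>E I X) = (\<Prod>i\<in>I. emeasure (k i x) (X i))" if x: "x \<in> space M" for x
      proof -
        interpret product_prob_space "\<lambda>i. k i x" I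
          using p[OF x] by (auto intro!: product_prob_space.intro product_prob_space_axioms.intro
             product_sigma_finite.intro prob_space_imp_sigma_finite)
        show ?thesis using X I sets_kernel[OF k x] by (intro emeasure_PiM) auto
      qed
      moreover have "(\<lambda>x. \<Prod>i\<in>I. emeasure (k i x) (X i)) \<in> borel_measurable M"
        using X by (intro borel_measurable_prod_ennreal measurable_compose[OF k measurable_emeasure_subprob_algebra]) auto
      ultimately show ?thesis by (subst measurable_cong) auto
    qed
    show "(\<lambda>x. emeasure (PiM I (\<lambda>i. k i x)) A) \<in> borel_measurable M" if "A \<in> prod_algebra I N" for A
      using that box unfolding prod_algebra_eq_finite[OF I] by auto
    show "(\<lambda>x. emeasure (PiM I (\<lambda>i. k i x)) (\<Pi>\<^sub>E i\<in>I. space (N i))) \<in> borel_measurable M"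
      by (rule box) auto
  qed
qed

section \<open>The law of the marks and the space of configurations\<close>

lemma prob_space_mark: "prob_space mark"
  unfolding mark_def by (rule prob_space_uniform_measure) auto

lemma sets_mark [simp, measurable_cong]: "sets mark = sets borel"
  unfolding mark_def by simp

lemma emeasure_mark_singleton: "emeasure mark {u} = 0"
proof -
  have "emeasure lborel ({0..1} \<inter> {u}) \<le> emeasure lborel {u}" by (rule emeasure_mono) auto
  then have "emeasure lborel ({0..1} \<inter> {u}) = 0" by simp
  then show ?thesis unfolding mark_def by (subst emeasure_uniform_measure) auto
qed

lemma space_CM: "space (CM N) = {..<N} \<rightarrow>\<^sub>E UNIV"
  unfolding CM_def by (simp add: space_PiM space_pair_measure)

text \<open>Indices outside the range are allowed because \<open>qidx\<close> is unrestricted where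
  no couple has the required rank; configurations are extensional, so such a coordinate is
  constant.\<close>

lemma measurable_CM_component [measurable]:
  "(\<lambda>c. c i) \<in> (CM N :: (nat \<Rightarrow> 'a::euclidean_space \<times> real) measure) \<rightarrow>\<^sub>M borel \<Otimes>\<^sub>M borel"
proof (cases "i < N")
  case True
  then show ?thesis unfolding CM_def by (intro measurable_component_singleton) auto
next
  case False
  then have "c i = undefined" if "c \<in> space (CM N :: (nat \<Rightarrow> 'a \<times> real) measure)" for c
    using that unfolding space_CM by (auto simp: PiE_def extensional_def)
  then show ?thesis by (subst measurable_cong[where g="\<lambda>_. undefined"]) (auto simp: space_pair_measure)
qed

section \<open>Measurability of selection and mutation\<close>

locale particle_kernels =
  fixes S :: "'a::euclidean_space \<Rightarrow> real" and K :: "nat \<Rightarrow> 'a \<Rightarrow> 'a measure" and \<alpha> :: real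
  assumes S_measurable [measurable]: "S \<in> borel_measurable borel"
    and K_markov: "\<And>p. K (Suc p) \<in> borel \<rightarrow>\<^sub>M prob_algebra borel"
    and \<alpha>: "0 < \<alpha>" "\<alpha> < 1"
begin

lemma K_subprob [measurable]: "K (Suc p) \<in> borel \<rightarrow>\<^sub>M subprob_algebra borel"
  using K_markov[of p] by (rule measurable_prob_algebraD)

lemma prob_space_K: "prob_space (K (Suc p) x)"
  using measurable_space[OF K_markov, of x p] by (simp add: space_prob_algebra)

lemma sets_K [simp, measurable_cong]: "sets (K (Suc p) x) = sets borel"
  using measurable_space[OF K_markov, of x p] by (simp add: space_prob_algebra)

lemma space_K [simp]: "space (K (Suc p) x) = UNIV"
  using sets_eq_imp_space_eq[OF sets_K] by simp

lemma cless_measurable [measurable]: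
  "Measurable.pred (CM N) (\<lambda>c. cless S (c i) (c j))"
proof -
  have [measurable]: "(\<lambda>c. S (fst (c i))) \<in> borel_measurable (CM N)" "(\<lambda>c :: nat \<Rightarrow> 'a \<times> real. snd (c i)) \<in> borel_measurable (CM N)" for i
    by measurable
  have "Measurable.pred (CM N) (\<lambda>c. S (fst (c i)) < S (fst (c j)))" for i j
    by (intro borel_measurable_pred_less) measurable
  moreover have "Measurable.pred (CM N) (\<lambda>c :: nat \<Rightarrow> 'a \<times> real. snd (c i) < snd (c j))"
    by (intro borel_measurable_pred_less) measurable
  ultimately have "Measurable.pred (CM N) (\<lambda>c. S (fst (c i)) < S (fst (c j)) \<or>
      (\<not> S (fst (c j)) < S (fst (c i)) \<and> snd (c i) < snd (c j)))"
    by (intro pred_intros_logic)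
  moreover have "cless S (c i) (c j) \<longleftrightarrow> S (fst (c i)) < S (fst (c j)) \<or>
      (\<not> S (fst (c j)) < S (fst (c i)) \<and> snd (c i) < snd (c j))" for c
    unfolding cless_def by auto
  ultimately show ?thesis by simp
qed

lemma qidx_measurable [measurable]: "qidx S \<alpha> N \<in> CM N \<rightarrow>\<^sub>M count_space UNIV"
proof -
  have c: "card {i. i < N \<and> Q i} = (\<Sum>i<N. if Q i then 1 else 0)" for Q
    by (subst sum.If_cases) (auto intro!: arg_cong[where f=card])
  show ?thesis
    unfolding qidx_def c by (rule measurable_Eps_nat[where N=N]) auto
qed

lemma qlev_measurable [measurable]: "qlev S \<alpha> N \<in> borel_measurable (CM N)"
  unfolding qlev_def[abs_def]
  by (rule measurable_compose_countable[where f="\<lambda>j c. S (fst (c j))" and g="qidx S \<alpha> N"]) measurable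

lemma surv_measurable [measurable]: "Measurable.pred (CM N) (\<lambda>c. i \<in> surv S \<alpha> N c)"
proof -
  have "Measurable.pred (CM N) (\<lambda>c. cless S (c (qidx S \<alpha> N c)) (c i))"
    by (rule measurable_compose_countable[where f="\<lambda>j c. cless S (c j) (c i)" and g="qidx S \<alpha> N"]) measurable
  then show ?thesis unfolding surv_def by simp
qed

lemma prob_space_Mker: "prob_space (Mker S K (Suc p) L x)"
  unfolding Mker_def using prob_space_K[of p x]
  by (auto intro!: prob_space_return prob_space.prob_space_distr)

lemma sets_Mker [simp, measurable_cong]: "sets (Mker S K (Suc p) L x) = sets borel"
  unfolding Mker_def by auto

text \<open>Measurability must be joint in level and position: the level is itself a function of the
  random configuration.\<close>

lemma Mker_measurable [measurable]:
  "(\<lambda>(L, x). Mker S K (Suc p) L x) \<in> borel \<Otimes>\<^sub>M borel \<rightarrow>\<^sub>M subprob_algebra borel"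
proof -
  have "(\<lambda>z. distr (K (Suc p) (snd z)) borel (\<lambda>y. if fst z \<le> S y then y else snd z))
      \<in> borel \<Otimes>\<^sub>M borel \<rightarrow>\<^sub>M subprob_algebra borel"
    by (rule measurable_distr2[where M=borel]) measurable
  moreover have "Measurable.pred (borel \<Otimes>\<^sub>M borel) (\<lambda>z. fst z \<le> S (snd z))" by measurable
  ultimately show ?thesis unfolding Mker_def split_beta by measurable
qed

definition child :: "nat \<Rightarrow> real \<Rightarrow> 'a \<Rightarrow> ('a \<times> real) measure" where
  "child p L x = Mker S K (Suc p) L x \<Otimes>\<^sub>M mark"

lemma sets_child [simp, measurable_cong]: "sets (child p L x) = sets (borel \<Otimes>\<^sub>M borel)"
  unfolding child_def by (intro sets_pair_measure_cong) auto

lemma prob_space_child: "prob_space (child p L x)"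
  unfolding child_def by (rule prob_space_pair[OF prob_space_Mker prob_space_mark])

lemma child_measurable [measurable]:
  "(\<lambda>(L, x). child p L x) \<in> borel \<Otimes>\<^sub>M borel \<rightarrow>\<^sub>M subprob_algebra (borel \<Otimes>\<^sub>M borel)"
proof -
  have "mark \<in> space (subprob_algebra borel)"
    by (simp add: space_subprob_algebra prob_space_imp_subprob_space prob_space_mark)
  then show ?thesis
    using measurable_pair_measure[OF Mker_measurable, of "\<lambda>_. mark" borel p]
    unfolding child_def split_beta by simp
qed

lemma partM_nonempty:
  assumes "surv S \<alpha> N c \<noteq> {}"
  shows "partM S K \<alpha> N p c i = uniform_count_measure (surv S \<alpha> N c) \<bind> (\<lambda>j. child p (qlev S \<alpha> N c) (fst (c j)))"
  using assms unfolding partM_def child_def by simp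

lemma child_measurable_uniform:
  "(\<lambda>j. child p L (x j)) \<in> uniform_count_measure A \<rightarrow>\<^sub>M subprob_algebra (borel \<Otimes>\<^sub>M borel)"
  by (subst measurable_cong_sets[OF sets_uniform_count_measure_count_space refl])
     (auto simp: space_subprob_algebra prob_space_imp_subprob_space prob_space_child)

lemma finite_surv [simp]: "finite (surv S \<alpha> N c)"
  using surv_subset by (rule finite_subset) simp

lemma prob_space_partM: "prob_space (partM S K \<alpha> N p c i)"
proof (cases "surv S \<alpha> N c = {}")
  case True
  then show ?thesis unfolding partM_def by (auto intro!: prob_space_return simp: space_pair_measure)
next
  case False
  interpret prob_space "uniform_count_measure (surv S \<alpha> N c)"
    using False by (intro prob_space_uniform_count_measure) auto
  show ?thesis unfolding partM_nonempty[OF False]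
    by (rule prob_space_bind[OF _ child_measurable_uniform]) (auto simp: prob_space_child)
qed

lemma sets_partM [simp, measurable_cong]: "sets (partM S K \<alpha> N p c i) = sets (borel \<Otimes>\<^sub>M borel)"
proof (cases "surv S \<alpha> N c = {}")
  case True
  then show ?thesis unfolding partM_def by simp
next
  case False
  then show ?thesis unfolding partM_nonempty[OF False]
    by (intro sets_bind) (auto simp: space_uniform_count_measure)
qed

lemma nn_integral_partM:
  assumes "surv S \<alpha> N c \<noteq> {}" and h: "h \<in> borel_measurable (borel \<Otimes>\<^sub>M borel)"
  shows "(\<integral>\<^sup>+z. h z \<partial>partM S K \<alpha> N p c i) =
    (\<Sum>j\<in>surv S \<alpha> N c. ennreal (1 / card (surv S \<alpha> N c)) * (\<integral>\<^sup>+z. h z \<partial>child p (qlev S \<alpha> N c) (fst (c j))))"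
  unfolding partM_nonempty[OF assms(1)] nn_integral_bind[OF h child_measurable_uniform]
  by (subst uniform_count_measure_def, subst nn_integral_point_measure_finite) auto

lemma partM_measurable:
  assumes "i < N"
  shows "(\<lambda>c. partM S K \<alpha> N p c i) \<in> CM N \<rightarrow>\<^sub>M subprob_algebra (borel \<Otimes>\<^sub>M borel)"
proof (rule measurable_subprob_algebra)
  fix X :: "('a \<times> real) set" assume X: "X \<in> sets (borel \<Otimes>\<^sub>M borel)"
  note [measurable] = X
  \<comment> \<open>The random survivor set is moved into indicators over the fixed range {0, ...,
    N-1}, including inside its own cardinality; every term is then visibly measurable in
    \<open>c\<close>.\<close>
  have eq: "emeasure (partM S K \<alpha> N p c i) X = (if \<forall>j<N. j \<notin> surv S \<alpha> N c then indicator X (c i) else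
     (\<Sum>j<N. if j \<in> surv S \<alpha> N c then ennreal (1 / real (\<Sum>j<N. if j \<in> surv S \<alpha> N c then 1 else 0))
        * emeasure (child p (qlev S \<alpha> N c) (fst (c j))) X else 0))" for c
  proof (cases "surv S \<alpha> N c = {}")
    case True
    then show ?thesis using X by (simp add: partM_def)
  next
    case False
    then have *: "\<not> (\<forall>j<N. j \<notin> surv S \<alpha> N c)" using surv_subset[of S \<alpha> N c] by auto
    have i: "{..<N} \<inter> surv S \<alpha> N c = surv S \<alpha> N c" using surv_subset[of S \<alpha> N c] by auto
    have "emeasure (partM S K \<alpha> N p c i) X = (\<integral>\<^sup>+z. indicator X z \<partial>partM S K \<alpha> N p c i)"
      using X by simp
    also have "\<dots> = (\<Sum>j\<in>surv S \<alpha> N c. ennreal (1 / card (surv S \<alpha> N c)) * emeasure (child p (qlev S \<alpha> N c) (fst (c j))) X)"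
      using X by (subst nn_integral_partM[OF False]) auto
    also have "\<dots> = (\<Sum>j<N. if j \<in> surv S \<alpha> N c then ennreal (1 / real (\<Sum>j<N. if j \<in> surv S \<alpha> N c then 1 else 0))
        * emeasure (child p (qlev S \<alpha> N c) (fst (c j))) X else 0)"
      by (simp add: sum.If_cases i)
    finally show ?thesis using * by (simp only: if_False)
  qed
  have [measurable]: "(\<lambda>c. emeasure (child p (qlev S \<alpha> N c) (fst (c j))) X) \<in> borel_measurable (CM N)" for j
  proof -
    have "(\<lambda>c. (qlev S \<alpha> N c, fst (c j))) \<in> CM N \<rightarrow>\<^sub>M borel \<Otimes>\<^sub>M borel" by measurable
    from measurable_compose[OF measurable_compose[OF this child_measurable[of p]] measurable_emeasure_subprob_algebra[OF X]]
    show ?thesis by simp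
  qed
  show "(\<lambda>c. emeasure (partM S K \<alpha> N p c i) X) \<in> borel_measurable (CM N)"
    unfolding eq by measurable
qed (auto simp: prob_space_partM prob_space_imp_subprob_space)

lemma stepM_measurable [measurable]: "stepM S K \<alpha> N p \<in> CM N \<rightarrow>\<^sub>M prob_algebra (CM N)"
  unfolding stepM_def[abs_def] CM_def
  by (rule PiM_prob_kernel) (auto intro!: partM_measurable[unfolded CM_def] prob_space_partM)

lemma stepM_measurable_subprob [measurable]: "stepM S K \<alpha> N p \<in> CM N \<rightarrow>\<^sub>M subprob_algebra (CM N)"
  using stepM_measurable by (rule measurable_prob_algebraD)

lemma prob_space_stepM: "prob_space (stepM S K \<alpha> N p c)"
  unfolding stepM_def by (intro prob_space_PiM prob_space_partM)

lemma sets_stepM [simp, measurable_cong]: "sets (stepM S K \<alpha> N p c) = sets (CM N)"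
  unfolding stepM_def CM_def by (intro sets_PiM_cong) auto

lemma space_stepM [simp]: "space (stepM S K \<alpha> N p c) = space (CM N)"
  using sets_eq_imp_space_eq[OF sets_stepM] .

end

section \<open>Products of probability measures\<close>

lemma indep_vars_PiM_coordinate:
  assumes "I \<noteq> {}" "\<And>i. i \<in> I \<Longrightarrow> prob_space (M i)"
  shows "prob_space.indep_vars (PiM I M) M (\<lambda>i c. c i) I"
proof -
  interpret prob_space "PiM I M" using assms by (intro prob_space_PiM)
  have "distr (PiM I M) (PiM I M) (\<lambda>c. \<lambda>i\<in>I. c i) = distr (PiM I M) (PiM I M) (\<lambda>c. c)"
    by (intro distr_cong) (auto simp: space_PiM PiE_restrict)
  also have "\<dots> = PiM I (\<lambda>i. distr (PiM I M) (M i) (\<lambda>c. c i))"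
    using assms by (simp add: distr_PiM_component cong: PiM_cong)
  finally show ?thesis
    using assms(1) by (subst indep_vars_iff_distr_eq_PiM') auto
qed

lemma integral_PiM_component:
  fixes f :: "'b \<Rightarrow> real"
  assumes "\<And>i. i \<in> I \<Longrightarrow> prob_space (M i)" "i \<in> I" "f \<in> borel_measurable (M i)"
  shows "(\<integral>c. f (c i) \<partial>PiM I M) = (\<integral>z. f z \<partial>M i)"
  using integral_distr[of "\<lambda>c. c i" "PiM I M" "M i" f] distr_PiM_component[of I M i] assms by simp

lemma nn_integral_PiM_component:
  assumes "\<And>i. i \<in> I \<Longrightarrow> prob_space (M i)" "i \<in> I" "f \<in> borel_measurable (M i)"
  shows "(\<integral>\<^sup>+c. f (c i) \<partial>PiM I M) = (\<integral>\<^sup>+z. f z \<partial>M i)"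
  using nn_integral_distr[of "\<lambda>c. c i" "PiM I M" "M i" f] distr_PiM_component[of I M i] assms by simp

text \<open>The range [-B, B] has length 2B, so Hoeffding's exponent -2 N e^2 / (2B)^2 simplifies to
  the stated one. Being linear in \<open>N\<close>, it gives a geometric series.\<close>

lemma Hoeffding_PiM:
  fixes f :: "'b \<Rightarrow> real" and N :: nat
  assumes M: "prob_space M" and f: "f \<in> borel_measurable M" "\<And>z. \<bar>f z\<bar> \<le> B" and B: "0 < B"
    and e: "0 < e" and N: "0 < N"
  shows "measure (PiM {..<N} (\<lambda>_. M)) {c \<in> space (PiM {..<N} (\<lambda>_. M)). e \<le> \<bar>(\<Sum>i<N. f (c i)) / N - (\<integral>z. f z \<partial>M)\<bar>}
    \<le> 2 * exp (- (e\<^sup>2 / (2 * B\<^sup>2)) * N)"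
proof -
  interpret prob_space "PiM {..<N} (\<lambda>_. M)" using M by (intro prob_space_PiM)
  note f(1)[measurable]
  have comp: "distr (PiM {..<N} (\<lambda>_. M)) borel (\<lambda>c. f (c i)) = distr M borel f" if "i < N" for i
    using distr_distr[of f M borel "\<lambda>c. c i" "PiM {..<N} (\<lambda>_. M)"] distr_PiM_component[of "{..<N}" "\<lambda>_. M" i] that M
    by (simp add: o_def)
  interpret Hoeffding_ineq_iid "PiM {..<N} (\<lambda>_. M)" "{..<N}" "\<lambda>i c. f (c i)" "\<lambda>c. f (c 0)" "- B" B
     "expectation (\<lambda>c. f (c 0))"
  proof unfold_locales
    show "indep_vars (\<lambda>_. borel) (\<lambda>i c. f (c i)) {..<N}"
      using N M by (intro indep_vars_compose2[OF indep_vars_PiM_coordinate]) (auto simp: lessThan_empty_iff)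
    show "distr (PiM {..<N} (\<lambda>_. M)) borel (\<lambda>c. f (c i)) = distr (PiM {..<N} (\<lambda>_. M)) borel (\<lambda>c. f (c 0))"
      if "i \<in> {..<N}" for i using that N by (simp add: comp)
    show "random_variable borel (\<lambda>c. f (c 0))"
      using N by (intro measurable_compose[OF _ f(1)] measurable_component_singleton) auto
    show "AE c in PiM {..<N} (\<lambda>_. M). f (c 0) \<in> {- B..B}"
      using f(2) by (auto simp: abs_le_iff intro!: AE_I2) (metis abs_le_iff minus_le_iff)
  qed simp_all
  have "expectation (\<lambda>c. f (c 0)) = (\<integral>z. f z \<partial>M)"
    using N M by (intro integral_PiM_component) auto
  moreover have "- 2 * real (card {..<N}) * e\<^sup>2 / (B - - B)\<^sup>2 = - (e\<^sup>2 / (2 * B\<^sup>2)) * N"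
    using B by (simp add: field_simps power2_eq_square)
  moreover have "0 \<le> e" "- B < B" "{..<N} \<noteq> {}" using e N B by (auto simp: lessThan_empty_iff)
  note Hoeffding_ineq_abs_ge'[OF this]
  ultimately show ?thesis by (simp only: card_lessThan)
qed

text \<open>For a fixed pair, integrate over coordinate \<open>i\<close> first with the others
  frozen: its mark would have to hit one prescribed value, which has probability 0. There are
  finitely many pairs.\<close>

lemma AE_PiM_distinct:
  fixes M :: "nat \<Rightarrow> ('a \<times> 'b :: {second_countable_topology, t2_space}) measure"
  assumes M: "\<And>i. prob_space (M i)" and sets: "\<And>i. sets (M i) = sets (A \<Otimes>\<^sub>M borel)"
    and atom: "\<And>i u. AE z in M i. snd z \<noteq> u"
  shows "AE c in PiM {..<N} M. inj_on (\<lambda>i. snd (c i)) {..<N}"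
proof -
  interpret product_prob_space M "{..<N}" using M by (rule product_prob_spaceI)
  note sets[measurable_cong]
  have *: "AE c in PiM {..<N} M. snd (c i) \<noteq> snd (c j)" if ij: "i < N" "j < N" "i \<noteq> j" for i j
  proof -
    define I where "I = {..<N} - {i}"
    have I: "finite I" "i \<notin> I" "insert i I = {..<N}" "j \<in> I" using ij unfolding I_def by auto
    have [measurable]: "{c \<in> space (PiM {..<N} M). snd (c i) = snd (c j)} \<in> sets (PiM {..<N} M)"
    proof (rule measurable_equality_set)
      have "snd \<in> M k \<rightarrow>\<^sub>M borel" for k by measurable
      then show "(\<lambda>c. snd (c i)) \<in> PiM {..<N} M \<rightarrow>\<^sub>M borel" "(\<lambda>c. snd (c j)) \<in> PiM {..<N} M \<rightarrow>\<^sub>M borel"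
        using ij by (auto intro!: measurable_compose[OF measurable_component_singleton])
    qed
    have "emeasure (PiM {..<N} M) {c \<in> space (PiM {..<N} M). snd (c i) = snd (c j)}
      = (\<integral>\<^sup>+c. indicator {c \<in> space (PiM {..<N} M). snd (c i) = snd (c j)} c \<partial>PiM (insert i I) M)"
      unfolding I(3) by simp
    also have "\<dots> = (\<integral>\<^sup>+x. (\<integral>\<^sup>+y. indicator {c \<in> space (PiM {..<N} M). snd (c i) = snd (c j)} (x(i := y)) \<partial>M i) \<partial>PiM I M)"
      by (rule product_nn_integral_insert) (auto simp: I)
    also have "\<dots> = (\<integral>\<^sup>+x. 0 \<partial>PiM I M)"
    proof (rule nn_integral_cong)
      fix x
      have "(\<integral>\<^sup>+y. indicator {c \<in> space (PiM {..<N} M). snd (c i) = snd (c j)} (x(i := y)) \<partial>M i) = (\<integral>\<^sup>+y. 0 \<partial>M i)"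
        using atom[where i=i and u="snd (x j)"] ij by (intro nn_integral_cong_AE) (auto elim!: eventually_mono)
      then show "(\<integral>\<^sup>+y. indicator {c \<in> space (PiM {..<N} M). snd (c i) = snd (c j)} (x(i := y)) \<partial>M i) = 0" by simp
    qed
    finally show ?thesis by (subst AE_iff_measurable[OF _ refl]) auto
  qed
  have "AE c in PiM {..<N} M. \<forall>i\<in>{..<N}. \<forall>j\<in>{..<N}. i \<noteq> j \<longrightarrow> snd (c i) \<noteq> snd (c j)"
  proof (intro AE_finite_allI)
    fix i j assume "i \<in> {..<N}" "j \<in> {..<N}"
    then show "AE c in PiM {..<N} M. i \<noteq> j \<longrightarrow> snd (c i) \<noteq> snd (c j)" using *[of i j] by (cases "i = j") auto
  qed auto
  then show ?thesis by eventually_elim (auto simp: inj_on_def)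
qed

lemma AE_pair_snd:
  assumes "sigma_finite_measure M2" and "AE y in M2. P y"
  shows "AE z in M1 \<Otimes>\<^sub>M M2. P (snd z)"
proof -
  interpret sigma_finite_measure M2 by fact
  from assms(2) obtain X where X: "X \<in> null_sets M2" "{y \<in> space M2. \<not> P y} \<subseteq> X"
    by (auto simp: eventually_ae_filter)
  have "space M1 \<times> X \<in> null_sets (M1 \<Otimes>\<^sub>M M2)"
    using X by (auto simp: null_sets_def emeasure_pair_measure_Times)
  then show ?thesis
    using X by (intro AE_I'[of "space M1 \<times> X"]) (auto simp: space_pair_measure)
qed

section \<open>Distinct marks and first moments after one step\<close>

context particle_kernels
begin

lemma AE_mark: "AE u in mark. u \<noteq> v"
  using emeasure_mark_singleton[of v] by (intro AE_I[of _ _ "{v}"]) auto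

lemma AE_child_mark: "AE z in child p L x. snd z \<noteq> u"
  unfolding child_def using prob_space_mark AE_mark by (intro AE_pair_snd prob_space_imp_sigma_finite)

lemma AE_partM_mark:
  assumes "surv S \<alpha> N c \<noteq> {}"
  shows "AE z in partM S K \<alpha> N p c i. snd z \<noteq> u"
proof -
  have "Measurable.pred (borel \<Otimes>\<^sub>M borel) (\<lambda>z :: 'a \<times> real. snd z \<noteq> u)" by measurable
  then show ?thesis
    unfolding partM_nonempty[OF assms] by (subst AE_bind[OF child_measurable_uniform]) (auto intro!: AE_I2 AE_child_mark)
qed

lemma distinct_marks_measurable [measurable]:
  "Measurable.pred (CM N :: (nat \<Rightarrow> 'a \<times> real) measure) (\<lambda>c. inj_on (\<lambda>i. snd (c i)) {..<N})"
proof -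
  have [measurable]: "Measurable.pred (CM N :: (nat \<Rightarrow> 'a \<times> real) measure) (\<lambda>c. snd (c i) = snd (c j))" for i j
    by (rule measurable_equality_set[unfolded pred_def[symmetric]]) measurable
  have "inj_on (\<lambda>i. snd (c i)) {..<N} \<longleftrightarrow> (\<forall>i\<in>{..<N}. \<forall>j\<in>{..<N}. i \<noteq> j \<longrightarrow> snd (c i) \<noteq> snd (c j))" for c :: "nat \<Rightarrow> 'a \<times> real"
    by (auto simp: inj_on_def)
  then show ?thesis by simp
qed

lemma AE_stepM_distinct:
  assumes "surv S \<alpha> N c \<noteq> {}"
  shows "AE c' in stepM S K \<alpha> N p c. inj_on (\<lambda>i. snd (c' i)) {..<N}"
  unfolding stepM_def using prob_space_partM AE_partM_mark[OF assms]
  by (intro AE_PiM_distinct[where A=borel]) auto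

text \<open>The particle ends at the proposal or stays at \<open>x\<close>, and \<open>h\<close> is
  nonnegative. The bound does not contain \<open>L\<close>, so it holds at a random level
  too.\<close>

lemma nn_integral_Mker_le:
  assumes [measurable]: "h \<in> borel_measurable borel"
  shows "(\<integral>\<^sup>+y. h y \<partial>Mker S K (Suc p) L x) \<le> (\<integral>\<^sup>+y. h y \<partial>K (Suc p) x) + h x"
proof (cases "L \<le> S x")
  case True
  interpret prob_space "K (Suc p) x" by (rule prob_space_K)
  have "(\<integral>\<^sup>+y. h y \<partial>Mker S K (Suc p) L x) = (\<integral>\<^sup>+y. h (if L \<le> S y then y else x) \<partial>K (Suc p) x)"
    unfolding Mker_def using True by (simp add: nn_integral_distr)
  also have "\<dots> \<le> (\<integral>\<^sup>+y. h y + h x \<partial>K (Suc p) x)" by (intro nn_integral_mono) auto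
  also have "\<dots> = (\<integral>\<^sup>+y. h y \<partial>K (Suc p) x) + h x"
    using emeasure_space_1 by (simp add: nn_integral_add)
  finally show ?thesis .
next
  case False
  then show ?thesis unfolding Mker_def by (simp add: nn_integral_return)
qed

lemma nn_integral_child:
  assumes [measurable]: "h \<in> borel_measurable borel"
  shows "(\<integral>\<^sup>+z. h (fst z) \<partial>child p L x) = (\<integral>\<^sup>+y. h y \<partial>Mker S K (Suc p) L x)"
proof -
  interpret prob_space mark by (rule prob_space_mark)
  have "(\<integral>\<^sup>+z. h (fst z) \<partial>child p L x) = (\<integral>\<^sup>+y. \<integral>\<^sup>+u. h y \<partial>mark \<partial>Mker S K (Suc p) L x)"
    unfolding child_def by (subst nn_integral_fst[symmetric]) (auto intro!: measurable_compose[OF measurable_fst])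
  then show ?thesis using emeasure_space_1 by simp
qed

text \<open>Each parent is drawn with probability at most 1/(N\<alpha>), and nonnegativity allows
  the sum over survivors to be enlarged to all particles. This removes both the random level and the
  random survivor set from the bound.\<close>

lemma nn_integral_stepM_le:
  assumes inj: "inj_on (\<lambda>i. snd (c i)) {..<N}" and q: "1 \<le> qrank \<alpha> N" and h[measurable]: "h \<in> borel_measurable borel"
  shows "(\<integral>\<^sup>+c'. (\<Sum>i<N. h (fst (c' i))) \<partial>stepM S K \<alpha> N p c)
    \<le> ennreal (1 / \<alpha>) * (\<Sum>i<N. (\<integral>\<^sup>+y. h y \<partial>K (Suc p) (fst (c i))) + h (fst (c i)))"
proof -
  let ?A = "surv S \<alpha> N c" and ?g = "\<lambda>x. (\<integral>\<^sup>+y. h y \<partial>K (Suc p) x) + h x"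
  have A: "?A \<noteq> {}" "real N * \<alpha> \<le> real (card ?A)" using card_surv_ge[OF inj q \<alpha>] by auto
  have N: "0 < N" using q qrank_le[OF \<alpha>(1), of N] by simp
  have part: "(\<integral>\<^sup>+z. h (fst z) \<partial>partM S K \<alpha> N p c i) \<le> ennreal (1 / (real N * \<alpha>)) * (\<Sum>j<N. ?g (fst (c j)))" for i
  proof -
    have "(\<integral>\<^sup>+z. h (fst z) \<partial>partM S K \<alpha> N p c i)
      = (\<Sum>j\<in>?A. ennreal (1 / card ?A) * (\<integral>\<^sup>+y. h y \<partial>Mker S K (Suc p) (qlev S \<alpha> N c) (fst (c j))))"
      by (subst nn_integral_partM[OF A(1)]) (auto simp: nn_integral_child)
    also have "\<dots> \<le> (\<Sum>j\<in>?A. ennreal (1 / (real N * \<alpha>)) * ?g (fst (c j)))"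
      using A(2) N \<alpha> order.strict_trans2[OF _ A(2), of 0]
      by (intro sum_mono mult_mono nn_integral_Mker_le h ennreal_leI divide_left_mono) auto
    also have "\<dots> \<le> (\<Sum>j<N. ennreal (1 / (real N * \<alpha>)) * ?g (fst (c j)))"
      using surv_subset[of S \<alpha> N c] by (intro sum_mono2) auto
    finally show ?thesis by (simp add: sum_distrib_left)
  qed
  have "(\<integral>\<^sup>+c'. (\<Sum>i<N. h (fst (c' i))) \<partial>stepM S K \<alpha> N p c)
     = (\<Sum>i<N. (\<integral>\<^sup>+c'. h (fst (c' i)) \<partial>stepM S K \<alpha> N p c))"
    by (rule nn_integral_sum) measurable
  also have "\<dots> = (\<Sum>i<N. (\<integral>\<^sup>+z. h (fst z) \<partial>partM S K \<alpha> N p c i))"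
  proof (rule sum.cong[OF refl])
    fix i assume "i \<in> {..<N}"
    moreover have "(\<lambda>z. h (fst z)) \<in> borel_measurable (partM S K \<alpha> N p c i)"
      unfolding measurable_cong_sets[OF sets_partM refl] by (rule measurable_compose[OF measurable_fst h])
    ultimately show "(\<integral>\<^sup>+c'. h (fst (c' i)) \<partial>stepM S K \<alpha> N p c) = (\<integral>\<^sup>+z. h (fst z) \<partial>partM S K \<alpha> N p c i)"
      unfolding stepM_def
      by (intro nn_integral_PiM_component[where f="\<lambda>z. h (fst z)"] prob_space_partM)
  qed
  also have "\<dots> \<le> (\<Sum>i<N. ennreal (1 / (real N * \<alpha>)) * (\<Sum>j<N. ?g (fst (c j))))"
    by (intro sum_mono part)
  also have "\<dots> = (of_nat N * ennreal (1 / (real N * \<alpha>))) * (\<Sum>j<N. ?g (fst (c j)))"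
    by (simp add: mult.assoc)
  also have "of_nat N * ennreal (1 / (real N * \<alpha>)) = ennreal (1 / \<alpha>)"
    using N \<alpha> by (simp add: ennreal_of_nat_eq_real_of_nat flip: ennreal_mult)
  finally show ?thesis .
qed

text \<open>With survivors present the law of a child does not depend on its index, so given the
  previous generation the children are i.i.d. and index 0 can represent them all.\<close>

lemma stepM_eq_PiM:
  assumes "surv S \<alpha> N c \<noteq> {}"
  shows "stepM S K \<alpha> N p c = PiM {..<N} (\<lambda>_. partM S K \<alpha> N p c 0)"
  unfolding stepM_def by (intro PiM_cong refl) (simp only: partM_nonempty[OF assms])

end

section \<open>Conditional means and reversibility\<close>

lemma integrable_bounded_prob:
  fixes f :: "'b \<Rightarrow> real"
  assumes "prob_space M" "f \<in> borel_measurable M" "\<And>x. \<bar>f x\<bar> \<le> B"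
  shows "integrable M f"
proof -
  interpret prob_space M by fact
  show ?thesis using assms by (intro integrable_const_bound[where B=B]) auto
qed

lemma abs_integral_le_prob:
  fixes f :: "'b \<Rightarrow> real"
  assumes "prob_space M" "f \<in> borel_measurable M" "\<And>x. \<bar>f x\<bar> \<le> B"
  shows "\<bar>\<integral>x. f x \<partial>M\<bar> \<le> B"
proof -
  interpret prob_space M by fact
  have "\<bar>\<integral>x. f x \<partial>M\<bar> \<le> (\<integral>x. \<bar>f x\<bar> \<partial>M)" by (rule integral_abs_bound)
  also have "\<dots> \<le> B"
    using assms by (intro integral_le_const integrable_abs integrable_bounded_prob) auto
  finally show ?thesis .
qed

context particle_kernels
begin

text \<open>At or above the level this is the integral of \<open>f\<close> against
  \<open>Mker\<close>: accepted proposals plus rejected mass. Below the level \<open>Mker\<close> is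
  a point mass and the two differ; the formula is kept there so that only the acceptance set varies
  with \<open>L\<close>. It is evaluated at survivors or multiplied by the indicator of the level
  set.\<close>

definition move :: "nat \<Rightarrow> real \<Rightarrow> ('a \<Rightarrow> real) \<Rightarrow> 'a \<Rightarrow> real" where
  "move p L f x = (\<integral>y. indicator {y. L \<le> S y} y * f y \<partial>K (Suc p) x) + f x * measure (K (Suc p) x) {y. \<not> L \<le> S y}"

lemma move_measurable [measurable]:
  assumes [measurable]: "f \<in> borel_measurable borel"
  shows "move p L f \<in> borel_measurable borel"
proof -
  have "(\<lambda>x. \<integral>y. indicator {y. L \<le> S y} y * f y \<partial>K (Suc p) x) \<in> borel_measurable borel"
    by (rule measurable_compose[OF K_subprob integral_measurable_subprob_algebra]) measurable
  moreover have "(\<lambda>x. measure (K (Suc p) x) {y. \<not> L \<le> S y}) \<in> borel_measurable borel"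
    by (rule measurable_compose[OF K_subprob measurable_measure_subprob_algebra]) measurable
  ultimately show ?thesis unfolding move_def[abs_def] by measurable
qed

lemma move_eq:
  assumes [measurable]: "f \<in> borel_measurable borel" and B: "\<And>x. \<bar>f x\<bar> \<le> B"
  shows "move p L f x = (\<integral>y. (if L \<le> S y then f y else f x) \<partial>K (Suc p) x)"
proof -
  have B0: "0 \<le> B" using B[of undefined] by linarith
  have i1: "integrable (K (Suc p) x) (\<lambda>y. indicator {y. L \<le> S y} y * f y)"
    using B B0 by (intro integrable_bounded_prob[OF prob_space_K, where B=B]) (auto simp: indicator_def)
  interpret prob_space "K (Suc p) x" by (rule prob_space_K)
  have i2: "integrable (K (Suc p) x) (\<lambda>y. f x * indicator {y. \<not> L \<le> S y} y)"
    using B B0 by (intro integrable_bounded_prob[OF prob_space_K, where B=B]) (auto simp: indicator_def)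
  have "(\<integral>y. (if L \<le> S y then f y else f x) \<partial>K (Suc p) x)
     = (\<integral>y. indicator {y. L \<le> S y} y * f y + f x * indicator {y. \<not> L \<le> S y} y \<partial>K (Suc p) x)"
    by (intro Bochner_Integration.integral_cong) (auto simp: indicator_def)
  also have "\<dots> = move p L f x"
    unfolding move_def using i1 i2 by (subst Bochner_Integration.integral_add) auto
  finally show ?thesis by simp
qed

lemma abs_move_le:
  assumes [measurable]: "f \<in> borel_measurable borel" and B: "\<And>x. \<bar>f x\<bar> \<le> B"
  shows "\<bar>move p L f x\<bar> \<le> B"
  unfolding move_eq[OF assms] using B by (intro abs_integral_le_prob prob_space_K) auto

text \<open>The two levels disagree on acceptance only for proposals with score in the band, and
  there the integrands differ by at most \<open>2 * B\<close>.\<close>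

lemma abs_move_diff_le:
  assumes [measurable]: "f \<in> borel_measurable borel" and B: "\<And>x. \<bar>f x\<bar> \<le> B" and L: "\<bar>L' - L\<bar> \<le> d"
  shows "\<bar>move p L' f x - move p L f x\<bar> \<le> 2 * B * measure (K (Suc p) x) {y. \<bar>S y - L\<bar> \<le> d}"
proof -
  interpret prob_space "K (Suc p) x" by (rule prob_space_K)
  have B0: "0 \<le> B" using B[of undefined] by linarith
  have i: "integrable (K (Suc p) x) (\<lambda>y. if L \<le> S y then f y else f x)" for L
    using B by (intro integrable_bounded_prob[OF prob_space_K, where B=B]) auto
  have "\<bar>move p L' f x - move p L f x\<bar> =
      \<bar>\<integral>y. (if L' \<le> S y then f y else f x) - (if L \<le> S y then f y else f x) \<partial>K (Suc p) x\<bar>"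
    unfolding move_eq[OF assms(1,2)] using i by simp
  also have "\<dots> \<le> (\<integral>y. \<bar>(if L' \<le> S y then f y else f x) - (if L \<le> S y then f y else f x)\<bar> \<partial>K (Suc p) x)"
    by (rule integral_abs_bound)
  also have "\<dots> \<le> (\<integral>y. 2 * B * indicator {y. \<bar>S y - L\<bar> \<le> d} y \<partial>K (Suc p) x)"
  proof (rule integral_mono)
    fix y
    have "\<bar>f y - f x\<bar> \<le> 2 * B" "\<bar>f x - f y\<bar> \<le> 2 * B" using B[of x] B[of y] by linarith+
    then show "\<bar>(if L' \<le> S y then f y else f x) - (if L \<le> S y then f y else f x)\<bar> \<le> 2 * B * indicator {y. \<bar>S y - L\<bar> \<le> d} y"
      using L B0 by (auto simp: indicator_def)
    show "integrable (K (Suc p) x) (\<lambda>y. 2 * B * indicator {y. \<bar>S y - L\<bar> \<le> d} y)"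
      using B0 by (intro integrable_bounded_prob[OF prob_space_K, where B="2 * B"]) (auto simp: indicator_def)
  qed (use i in auto)
  also have "\<dots> = 2 * B * measure (K (Suc p) x) {y. \<bar>S y - L\<bar> \<le> d}" by simp
  finally show ?thesis .
qed

lemma integral_Mker:
  assumes [measurable]: "f \<in> borel_measurable borel" and B: "\<And>x. \<bar>f x\<bar> \<le> B" and L: "L \<le> S x"
  shows "(\<integral>y. f y \<partial>Mker S K (Suc p) L x) = move p L f x"
  unfolding move_eq[OF assms(1,2)] Mker_def using L by (simp add: integral_distr if_distrib)

lemma integral_child:
  fixes f :: "'a \<Rightarrow> real"
  assumes f[measurable]: "f \<in> borel_measurable borel" and B: "\<And>x. \<bar>f x\<bar> \<le> B"
  shows "(\<integral>z. f (fst z) \<partial>child p L x) = (\<integral>y. f y \<partial>Mker S K (Suc p) L x)"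
proof -
  interpret M: prob_space "Mker S K (Suc p) L x" by (rule prob_space_Mker)
  interpret m: prob_space mark by (rule prob_space_mark)
  interpret pair_sigma_finite "Mker S K (Suc p) L x" mark ..
  have m: "(\<lambda>z. f (fst z)) \<in> borel_measurable (child p L x)"
    unfolding measurable_cong_sets[OF sets_child refl] by (rule measurable_compose[OF measurable_fst f])
  have "integrable (child p L x) (\<lambda>z. f (fst z))"
    using B by (intro integrable_bounded_prob[OF prob_space_child m])
  then have "(\<integral>z. f (fst z) \<partial>child p L x) = (\<integral>y. \<integral>u. f y \<partial>mark \<partial>Mker S K (Suc p) L x)"
    unfolding child_def by (subst integral_fst'[symmetric]) auto
  then show ?thesis using m.prob_space by simp
qed

lemma integral_partM:
  assumes f[measurable]: "f \<in> borel_measurable borel" and B: "\<And>x. \<bar>f x\<bar> \<le> B" and ne: "surv S \<alpha> N c \<noteq> {}"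
  shows "(\<integral>z. f (fst z) \<partial>partM S K \<alpha> N p c i) =
    (\<Sum>j\<in>surv S \<alpha> N c. move p (qlev S \<alpha> N c) f (fst (c j))) / card (surv S \<alpha> N c)"
proof -
  interpret prob_space "uniform_count_measure (surv S \<alpha> N c)"
    using ne by (intro prob_space_uniform_count_measure) auto
  have m: "(\<lambda>z. f (fst z)) \<in> borel_measurable (borel \<Otimes>\<^sub>M borel)"
    by (rule measurable_compose[OF measurable_fst f])
  have "(\<integral>z. f (fst z) \<partial>partM S K \<alpha> N p c i)
    = (\<integral>j. \<integral>z. f (fst z) \<partial>child p (qlev S \<alpha> N c) (fst (c j)) \<partial>uniform_count_measure (surv S \<alpha> N c))"
    unfolding partM_nonempty[OF ne] using B
    by (intro integral_bind[OF m _ child_measurable_uniform, where B=B and B'=1])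
       (auto simp: finite_measure_axioms prob_space.emeasure_space_1[OF prob_space_child, simplified] space_pair_measure)
  also have "\<dots> = (\<Sum>j\<in>surv S \<alpha> N c. \<integral>z. f (fst z) \<partial>child p (qlev S \<alpha> N c) (fst (c j))) / card (surv S \<alpha> N c)"
    by (rule integral_uniform_count_measure) simp
  \<comment> \<open>Survivors score at least the quantile level, which is where \<open>move\<close>
    agrees with the kernel.\<close>
  also have "(\<Sum>j\<in>surv S \<alpha> N c. \<integral>z. f (fst z) \<partial>child p (qlev S \<alpha> N c) (fst (c j)))
     = (\<Sum>j\<in>surv S \<alpha> N c. move p (qlev S \<alpha> N c) f (fst (c j)))"
    using B surv_level(2)[where S=S and \<alpha>=\<alpha> and N=N and c=c]
    by (intro sum.cong refl) (simp add: integral_child[OF f B] integral_Mker[OF f B])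
  finally show ?thesis .
qed

end

section \<open>Reversibility and invariance of the restricted law\<close>

locale splitting = particle_kernels S K \<alpha>
  for S :: "'a::euclidean_space \<Rightarrow> real" and K \<alpha> +
  fixes \<eta> :: "'a \<Rightarrow> real"
  assumes eta_measurable [measurable]: "\<eta> \<in> borel_measurable borel"
    and eta_prob: "(\<integral>\<^sup>+x. ennreal (\<eta> x) \<partial>lborel) = 1"
    and K_rev: "\<And>p A B. A \<in> sets borel \<Longrightarrow> B \<in> sets borel \<Longrightarrow>
        (\<integral>\<^sup>+x. indicator A x * emeasure (K (Suc p) x) B \<partial>etaM \<eta>)
      = (\<integral>\<^sup>+x. indicator B x * emeasure (K (Suc p) x) A \<partial>etaM \<eta>)"
begin

abbreviation "\<mu> \<equiv> etaM \<eta>"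

lemma sets_eta [simp, measurable_cong]: "sets \<mu> = sets borel"
  unfolding etaM_def by simp

lemma space_eta [simp]: "space \<mu> = UNIV"
  unfolding etaM_def by simp

sublocale prob_space \<mu>
  by rule (simp add: etaM_def emeasure_density eta_prob)

lemma K_subprob_density: "K (Suc p) \<in> density \<mu> g \<rightarrow>\<^sub>M subprob_algebra borel"
  using K_subprob[of p] by (simp add: measurable_cong_sets[of "density \<mu> g" borel])

text \<open>Detailed balance on rectangles, read for fixed \<open>A\<close> as an equality of
  measures in the other set. In this form it passes from sets to functions through the integral
  formulas for \<open>bind\<close>.\<close>

lemma reversible_bind:
  assumes [measurable]: "A \<in> sets borel"
  shows "density \<mu> (indicator A) \<bind> K (Suc p) = density \<mu> (\<lambda>x. emeasure (K (Suc p) x) A)"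
proof (rule measure_eqI)
  show s: "sets (density \<mu> (indicator A) \<bind> K (Suc p)) = sets (density \<mu> (\<lambda>x. emeasure (K (Suc p) x) A))"
    by (subst sets_bind[where N=borel]) auto
  fix B assume "B \<in> sets (density \<mu> (indicator A) \<bind> K (Suc p))"
  then have [measurable]: "B \<in> sets borel" using s by simp
  have "emeasure (density \<mu> (indicator A) \<bind> K (Suc p)) B = (\<integral>\<^sup>+x. emeasure (K (Suc p) x) B \<partial>density \<mu> (indicator A))"
    by (rule emeasure_bind[OF _ K_subprob_density]) auto
  also have "\<dots> = (\<integral>\<^sup>+x. indicator A x * emeasure (K (Suc p) x) B \<partial>\<mu>)"
    by (subst nn_integral_density) auto
  also have "\<dots> = (\<integral>\<^sup>+x. indicator B x * emeasure (K (Suc p) x) A \<partial>\<mu>)"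
    by (rule K_rev) auto
  also have "\<dots> = emeasure (density \<mu> (\<lambda>x. emeasure (K (Suc p) x) A)) B"
    by (subst emeasure_density) (auto simp: mult.commute)
  finally show "emeasure (density \<mu> (indicator A) \<bind> K (Suc p)) B = emeasure (density \<mu> (\<lambda>x. emeasure (K (Suc p) x) A)) B" .
qed

text \<open>Stationarity is the case \<open>A = UNIV\<close> of reversibility, since the density is
  then \<open>K (Suc p) x UNIV\<close>, which is 1.\<close>

lemma nn_integral_K_invariant:
  assumes [measurable]: "h \<in> borel_measurable borel"
  shows "(\<integral>\<^sup>+x. \<integral>\<^sup>+y. h y \<partial>K (Suc p) x \<partial>\<mu>) = (\<integral>\<^sup>+x. h x \<partial>\<mu>)"
proof -
  have 1: "emeasure (K (Suc p) x) UNIV = 1" for x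
    using prob_space.emeasure_space_1[OF prob_space_K] by simp
  have "(\<integral>\<^sup>+x. \<integral>\<^sup>+y. h y \<partial>K (Suc p) x \<partial>\<mu>) = (\<integral>\<^sup>+x. \<integral>\<^sup>+y. h y \<partial>K (Suc p) x \<partial>density \<mu> (indicator UNIV))"
    by (simp add: density_1)
  also have "\<dots> = (\<integral>\<^sup>+x. h x \<partial>(density \<mu> (indicator UNIV) \<bind> K (Suc p)))"
    by (rule nn_integral_bind[OF _ K_subprob_density, symmetric]) simp
  also have "\<dots> = (\<integral>\<^sup>+x. h x \<partial>\<mu>)"
    by (subst reversible_bind) (simp_all add: 1 density_1)
  finally show ?thesis .
qed

lemma integral_reversible:
  fixes f :: "'a \<Rightarrow> real"
  assumes [measurable]: "A \<in> sets borel" "f \<in> borel_measurable borel" and B: "\<And>x. \<bar>f x\<bar> \<le> B"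
  shows "(\<integral>x. indicator A x * (\<integral>y. f y \<partial>K (Suc p) x) \<partial>\<mu>) = (\<integral>x. measure (K (Suc p) x) A * f x \<partial>\<mu>)"
proof -
  have e: "emeasure (K (Suc p) x) X = ennreal (measure (K (Suc p) x) X)" for x X
    using prob_space_K[of p x] by (simp add: finite_measure.emeasure_eq_measure prob_space.finite_measure)
  have [measurable]: "(\<lambda>x. measure (K (Suc p) x) A) \<in> borel_measurable borel"
    by (rule measurable_compose[OF K_subprob measurable_measure_subprob_algebra]) measurable
  have [measurable]: "(\<lambda>x. \<integral>y. f y \<partial>K (Suc p) x) \<in> borel_measurable borel"
    by (rule measurable_compose[OF K_subprob integral_measurable_subprob_algebra]) measurable
  have "finite_measure (density \<mu> (indicator A))"
    by (rule finite_measureI) (simp add: emeasure_density)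
  then have "(\<integral>x. f x \<partial>(density \<mu> (indicator A) \<bind> K (Suc p))) = (\<integral>x. \<integral>y. f y \<partial>K (Suc p) x \<partial>density \<mu> (indicator A))"
    using B by (intro integral_bind[OF _ _ K_subprob_density, where B=B and B'=1])
      (auto simp: prob_space.emeasure_space_1[OF prob_space_K, simplified])
  also have "\<dots> = (\<integral>x. indicator A x * (\<integral>y. f y \<partial>K (Suc p) x) \<partial>\<mu>)"
    using integral_real_density[of "indicator A" \<mu> "\<lambda>x. \<integral>y. f y \<partial>K (Suc p) x"] by (simp add: ennreal_indicator)
  finally have "(\<integral>x. indicator A x * (\<integral>y. f y \<partial>K (Suc p) x) \<partial>\<mu>) = (\<integral>x. f x \<partial>density \<mu> (\<lambda>x. emeasure (K (Suc p) x) A))"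
    by (simp add: reversible_bind)
  also have "\<dots> = (\<integral>x. measure (K (Suc p) x) A * f x \<partial>\<mu>)"
    unfolding e by (subst integral_real_density) auto
  finally show ?thesis .
qed

text \<open>Write A for the level set. By reversibility, the accepted part, started in A and landing
  in A, integrates to that of \<open>K(x, A) * f x\<close> over A. The rejected part contributes
  \<open>(1 - K(x, A)) * f x\<close> over A, and the two add up to \<open>f\<close> on A.\<close>

lemma integral_move:
  fixes f :: "'a \<Rightarrow> real"
  assumes [measurable]: "f \<in> borel_measurable borel" and B: "\<And>x. \<bar>f x\<bar> \<le> B"
  shows "(\<integral>x. indicator {x. L \<le> S x} x * move p L f x \<partial>\<mu>) = (\<integral>x. indicator {x. L \<le> S x} x * f x \<partial>\<mu>)"
proof -
  let ?A = "{x. L \<le> S x}" and ?K = "K (Suc p)"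
  have B0: "0 \<le> B" using B[of undefined] by linarith
  have [measurable]: "(\<lambda>x. measure (?K x) ?A) \<in> borel_measurable borel"
    by (rule measurable_compose[OF K_subprob measurable_measure_subprob_algebra]) measurable
  have g: "\<bar>indicator ?A y * f y\<bar> \<le> B" for y using B[of y] B0 by (auto simp: indicator_def)
  have [measurable]: "(\<lambda>x. \<integral>y. indicator ?A y * f y \<partial>?K x) \<in> borel_measurable borel"
    by (rule measurable_compose[OF K_subprob integral_measurable_subprob_algebra]) measurable
  have m01: "0 \<le> measure (?K x) X" "measure (?K x) X \<le> 1" for x X
    using prob_space.prob_le_1[OF prob_space_K] by auto
  have compl: "measure (?K x) {y. \<not> L \<le> S y} = 1 - measure (?K x) ?A" for x
  proof -
    have "{y. \<not> L \<le> S y} = space (?K x) - ?A" by auto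
    then show ?thesis using prob_space.prob_compl[OF prob_space_K, of ?A p x] by simp
  qed
  have i1: "integrable \<mu> (\<lambda>x. indicator ?A x * (\<integral>y. indicator ?A y * f y \<partial>?K x))"
  proof (rule integrable_bounded_prob[where B=B])
    fix x
    have "\<bar>\<integral>y. indicator ?A y * f y \<partial>?K x\<bar> \<le> B" using g by (intro abs_integral_le_prob prob_space_K) auto
    then show "\<bar>indicator ?A x * (\<integral>y. indicator ?A y * f y \<partial>?K x)\<bar> \<le> B" using B0 by (auto simp: indicator_def)
  qed (auto simp: prob_space_axioms)
  have i2: "integrable \<mu> (\<lambda>x. indicator ?A x * f x)"
    using g by (intro integrable_bounded_prob[where B=B]) (auto simp: prob_space_axioms)
  have i3: "integrable \<mu> (\<lambda>x. measure (?K x) ?A * (indicator ?A x * f x))"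
  proof (rule integrable_bounded_prob[where B=B])
    show "\<bar>measure (?K x) ?A * (indicator ?A x * f x)\<bar> \<le> B" for x
      using mult_mono[OF m01(2)[of x ?A] g[of x]] B0 m01[of x ?A] by (simp add: abs_mult)
  qed (auto simp: prob_space_axioms)
  have "(\<integral>x. indicator ?A x * move p L f x \<partial>\<mu>) =
     (\<integral>x. indicator ?A x * (\<integral>y. indicator ?A y * f y \<partial>?K x) + (indicator ?A x * f x - measure (?K x) ?A * (indicator ?A x * f x)) \<partial>\<mu>)"
    unfolding move_def compl by (intro Bochner_Integration.integral_cong) (auto simp: algebra_simps)
  also have "\<dots> = (\<integral>x. indicator ?A x * (\<integral>y. indicator ?A y * f y \<partial>?K x) \<partial>\<mu>)
     + ((\<integral>x. indicator ?A x * f x \<partial>\<mu>) - (\<integral>x. measure (?K x) ?A * (indicator ?A x * f x) \<partial>\<mu>))"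
    using i1 i2 i3 by simp
  also have "(\<integral>x. indicator ?A x * (\<integral>y. indicator ?A y * f y \<partial>?K x) \<partial>\<mu>) = (\<integral>x. measure (?K x) ?A * (indicator ?A x * f x) \<partial>\<mu>)"
    using g by (intro integral_reversible) auto
  finally show ?thesis by simp
qed

end

section \<open>Laws of the generations\<close>

context splitting
begin

abbreviation "T N k \<equiv> traj \<eta> S K \<alpha> N k"
abbreviation "init N \<equiv> PiM {..<N} (\<lambda>_. \<mu> \<Otimes>\<^sub>M mark)"

lemma prob_space_eta_mark: "prob_space (\<mu> \<Otimes>\<^sub>M mark)"
  by (rule prob_space_pair[OF prob_space_axioms prob_space_mark])

lemma sets_init [simp]: "sets (init N) = sets (CM N)"
  unfolding CM_def by (intro sets_PiM_cong) auto

lemma space_init [simp]: "space (init N) = space (CM N)"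
  using sets_eq_imp_space_eq[OF sets_init] .

lemma prob_space_init: "prob_space (init N)"
  by (intro prob_space_PiM prob_space_eta_mark)

lemma measurable_init: "(\<lambda>c. \<lambda>k\<in>{..0}. c) \<in> init N \<rightarrow>\<^sub>M PiM {..0::nat} (\<lambda>_. CM N)"
  unfolding measurable_cong_sets[OF sets_init refl] by (rule measurable_restrict) simp

lemma measurable_extend:
  "(\<lambda>(\<omega>, c). fun_upd \<omega> (Suc k) c) \<in> PiM {..k} (\<lambda>_. CM N) \<Otimes>\<^sub>M CM N \<rightarrow>\<^sub>M PiM {..Suc k} (\<lambda>_. CM N)"
  unfolding atMost_Suc by (rule measurable_add_dim)

lemma measurable_extend_snd:
  assumes "\<omega> \<in> space (PiM {..k} (\<lambda>_. CM N))"
  shows "(\<lambda>c. fun_upd \<omega> (Suc k) c) \<in> CM N \<rightarrow>\<^sub>M PiM {..Suc k} (\<lambda>_. CM N)"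
  using measurable_compose[OF measurable_Pair1'[OF assms] measurable_extend] by simp

lemma measurable_gen:
  "p \<le> k \<Longrightarrow> (\<lambda>\<omega>. \<omega> p) \<in> PiM {..k} (\<lambda>_. CM N) \<rightarrow>\<^sub>M CM N"
  by (rule measurable_component_singleton) simp

lemma traj_kernel:
  "(\<lambda>\<omega>. distr (stepM S K \<alpha> N k (\<omega> k)) (PiM {..Suc k} (\<lambda>_. CM N)) (\<lambda>c. fun_upd \<omega> (Suc k) c))
    \<in> PiM {..k} (\<lambda>_. CM N) \<rightarrow>\<^sub>M subprob_algebra (PiM {..Suc k} (\<lambda>_. CM N))"
  by (rule measurable_distr2[OF measurable_extend measurable_compose[OF measurable_gen stepM_measurable_subprob]]) simp

text \<open>The two claims need a joint induction: the kernel is measurable only once the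
  \<sigma>-algebra of the previous law is known, and the \<sigma>-algebra of a \<open>bind\<close>
  is determined because a probability space is nonempty.\<close>

lemma traj_wf: "sets (T N k) = sets (PiM {..k} (\<lambda>_. CM N)) \<and> prob_space (T N k)"
proof (induction k)
  case 0
  show ?case
    using prob_space.prob_space_distr[OF prob_space_init measurable_init] by simp
next
  case (Suc k)
  then have s: "sets (T N k) = sets (PiM {..k} (\<lambda>_. CM N))" and p: "prob_space (T N k)" by auto
  interpret T: prob_space "T N k" by fact
  have sp: "space (T N k) = space (PiM {..k} (\<lambda>_. CM N))" using sets_eq_imp_space_eq[OF s] .
  have k: "(\<lambda>\<omega>. distr (stepM S K \<alpha> N k (\<omega> k)) (PiM {..Suc k} (\<lambda>_. CM N)) (\<lambda>c. fun_upd \<omega> (Suc k) c))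
    \<in> T N k \<rightarrow>\<^sub>M subprob_algebra (PiM {..Suc k} (\<lambda>_. CM N))"
    unfolding measurable_cong_sets[OF s refl] by (rule traj_kernel)
  have "prob_space (T N (Suc k))"
    unfolding traj.simps
  proof (rule T.prob_space_bind[OF AE_I2 k])
    fix \<omega> assume "\<omega> \<in> space (T N k)"
    then show "prob_space (distr (stepM S K \<alpha> N k (\<omega> k)) (PiM {..Suc k} (\<lambda>_. CM N)) (\<lambda>c. fun_upd \<omega> (Suc k) c))"
      unfolding sp by (intro prob_space.prob_space_distr prob_space_stepM)
        (simp add: measurable_cong_sets[OF sets_stepM refl] measurable_extend_snd)
  qed
  moreover have "sets (T N (Suc k)) = sets (PiM {..Suc k} (\<lambda>_. CM N))"
    unfolding traj.simps by (rule sets_bind) (auto simp: T.not_empty)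
  ultimately show ?case by blast
qed

lemma sets_traj [simp]: "sets (T N k) = sets (PiM {..k} (\<lambda>_. CM N))"
  and prob_space_traj: "prob_space (T N k)"
  using traj_wf by auto

lemma space_traj [simp]: "space (T N k) = space (PiM {..k} (\<lambda>_. CM N))"
  using sets_eq_imp_space_eq[OF sets_traj] .

lemma traj_kernel':
  "(\<lambda>\<omega>. distr (stepM S K \<alpha> N k (\<omega> k)) (PiM {..Suc k} (\<lambda>_. CM N)) (\<lambda>c. fun_upd \<omega> (Suc k) c))
    \<in> T N k \<rightarrow>\<^sub>M subprob_algebra (PiM {..Suc k} (\<lambda>_. CM N))"
  unfolding measurable_cong_sets[OF sets_traj refl] by (rule traj_kernel)

lemma nn_integral_traj_0:
  assumes h: "h \<in> borel_measurable (CM N)"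
  shows "(\<integral>\<^sup>+\<omega>. h (\<omega> 0) \<partial>T N 0) = (\<integral>\<^sup>+c. h c \<partial>init N)"
proof -
  have "(\<lambda>\<omega>. h (\<omega> 0)) \<in> borel_measurable (PiM {..0::nat} (\<lambda>_. CM N))"
    by (rule measurable_compose[OF measurable_gen[OF order_refl] h])
  then have "(\<lambda>\<omega>. h (\<omega> 0)) \<in> borel_measurable (T N 0)"
    by (simp only: measurable_cong_sets[OF sets_traj refl])
  from nn_integral_distr[OF measurable_init this[unfolded traj.simps]]
  show ?thesis unfolding traj.simps by simp
qed

lemma nn_integral_traj_Suc:
  assumes h: "h \<in> borel_measurable (PiM {..Suc k} (\<lambda>_. CM N))"
  shows "(\<integral>\<^sup>+\<omega>. h \<omega> \<partial>T N (Suc k)) = (\<integral>\<^sup>+\<omega>. (\<integral>\<^sup>+c. h (fun_upd \<omega> (Suc k) c) \<partial>stepM S K \<alpha> N k (\<omega> k)) \<partial>T N k)"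
  unfolding traj.simps nn_integral_bind[OF h traj_kernel']
  using h by (intro nn_integral_cong nn_integral_distr)
    (auto simp: measurable_cong_sets[OF sets_stepM refl] measurable_extend_snd)

text \<open>Consistency of the laws: a later generation only adds a coordinate, which the
  restriction hides, and its kernel has total mass 1. The restriction returns trajectories to the
  extensional space of the shorter law.\<close>

lemma nn_integral_traj_drop:
  assumes "m \<le> k" and h: "h \<in> borel_measurable (PiM {..m} (\<lambda>_. CM N))"
  shows "(\<integral>\<^sup>+\<omega>. h (restrict \<omega> {..m}) \<partial>T N k) = (\<integral>\<^sup>+\<omega>. h \<omega> \<partial>T N m)"
  using \<open>m \<le> k\<close>
proof (induction k rule: dec_induct)
  case base
  show ?case
    by (intro nn_integral_cong) (auto simp: space_PiM PiE_restrict)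
next
  case (step k)
  have m: "(\<lambda>\<omega>. h (restrict \<omega> {..m})) \<in> borel_measurable (PiM {..Suc k} (\<lambda>_. CM N))"
    using step(1) by (intro measurable_compose[OF measurable_restrict_subset h]) auto
  have "(\<integral>\<^sup>+\<omega>. h (restrict \<omega> {..m}) \<partial>T N (Suc k))
     = (\<integral>\<^sup>+\<omega>. (\<integral>\<^sup>+c. h (restrict \<omega> {..m}) \<partial>stepM S K \<alpha> N k (\<omega> k)) \<partial>T N k)"
    using step(1) by (subst nn_integral_traj_Suc[OF m])
      (intro nn_integral_cong arg_cong[where f=h], auto simp: fun_eq_iff)
  also have "\<dots> = (\<integral>\<^sup>+\<omega>. h (restrict \<omega> {..m}) \<partial>T N k)"
    using prob_space.emeasure_space_1[OF prob_space_stepM] by simp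
  also note step.IH
  finally show ?case .
qed

lemma nn_integral_gen:
  assumes "p \<le> k" and h: "h \<in> borel_measurable (CM N)"
  shows "(\<integral>\<^sup>+\<omega>. h (\<omega> p) \<partial>T N k) = (\<integral>\<^sup>+\<omega>. h (\<omega> p) \<partial>T N p)"
  using nn_integral_traj_drop[OF assms(1) measurable_compose[OF measurable_gen[OF order_refl] h]] by simp

lemma nn_integral_gen_0:
  assumes h: "h \<in> borel_measurable (CM N)"
  shows "(\<integral>\<^sup>+\<omega>. h (\<omega> 0) \<partial>T N k) = (\<integral>\<^sup>+c. h c \<partial>init N)"
  using nn_integral_gen[OF _ h, of 0 k] nn_integral_traj_0[OF h] by simp

text \<open>The Markov property of the sequence of generations: conditioning on generation
  \<open>p\<close>, the next one is drawn from \<open>stepM\<close>.\<close>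

lemma nn_integral_gen_pair:
  assumes "Suc p \<le> k" and h: "case_prod h \<in> borel_measurable (CM N \<Otimes>\<^sub>M CM N)"
  shows "(\<integral>\<^sup>+\<omega>. h (\<omega> p) (\<omega> (Suc p)) \<partial>T N k)
     = (\<integral>\<^sup>+\<omega>. (\<integral>\<^sup>+c. h (\<omega> p) c \<partial>stepM S K \<alpha> N p (\<omega> p)) \<partial>T N p)"
proof -
  have m: "(\<lambda>\<omega>. h (\<omega> p) (\<omega> (Suc p))) \<in> borel_measurable (PiM {..Suc p} (\<lambda>_. CM N))"
    using measurable_compose[OF measurable_Pair[OF measurable_gen[of p "Suc p"] measurable_gen[of "Suc p" "Suc p"]] h] by simp
  have "(\<integral>\<^sup>+\<omega>. h (\<omega> p) (\<omega> (Suc p)) \<partial>T N k) = (\<integral>\<^sup>+\<omega>. h (\<omega> p) (\<omega> (Suc p)) \<partial>T N (Suc p))"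
    using nn_integral_traj_drop[OF assms(1) m] by simp
  also have "\<dots> = (\<integral>\<^sup>+\<omega>. (\<integral>\<^sup>+c. h (\<omega> p) c \<partial>stepM S K \<alpha> N p (\<omega> p)) \<partial>T N p)"
    by (subst nn_integral_traj_Suc[OF m]) simp
  finally show ?thesis .
qed

text \<open>Distinct marks at one generation make the survivor set nonempty, so the next generation
  is drawn with fresh atomless marks instead of by the default branch of
  \<open>partM\<close>.\<close>

lemma AE_traj_distinct:
  assumes q: "1 \<le> qrank \<alpha> N"
  shows "AE \<omega> in T N p. inj_on (\<lambda>i. snd (\<omega> p i)) {..<N}"
proof (induction p)
  case 0
  have "AE z in \<mu> \<Otimes>\<^sub>M mark. snd z \<noteq> u" for u
    using prob_space_mark AE_mark by (intro AE_pair_snd prob_space_imp_sigma_finite)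
  then have "AE c in init N. inj_on (\<lambda>i. snd (c i)) {..<N}"
    using prob_space_eta_mark by (intro AE_PiM_distinct[where A=borel]) auto
  then show ?case
    unfolding traj.simps by (subst AE_distr_iff[OF measurable_init])
      (auto simp: pred_def[symmetric] intro!: measurable_compose[OF measurable_gen distinct_marks_measurable])
next
  case (Suc p)
  have m: "Measurable.pred (PiM {..Suc p} (\<lambda>_. CM N :: (nat \<Rightarrow> 'a \<times> real) measure)) (\<lambda>\<omega>. inj_on (\<lambda>i. snd (\<omega> (Suc p) i)) {..<N})"
    by (rule measurable_compose[OF measurable_gen distinct_marks_measurable]) simp
  show ?case
    unfolding traj.simps AE_bind[OF traj_kernel' m]
  proof (rule AE_mp[OF Suc AE_I2], rule impI)
    fix \<omega> assume \<omega>: "\<omega> \<in> space (T N p)" and inj: "inj_on (\<lambda>i. snd (\<omega> p i)) {..<N}"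
    have e: "(\<lambda>c. fun_upd \<omega> (Suc p) c) \<in> stepM S K \<alpha> N p (\<omega> p) \<rightarrow>\<^sub>M PiM {..Suc p} (\<lambda>_. CM N)"
      using \<omega> by (simp add: measurable_cong_sets[OF sets_stepM refl] measurable_extend_snd)
    show "AE \<omega>' in distr (stepM S K \<alpha> N p (\<omega> p)) (PiM {..Suc p} (\<lambda>_. CM N)) (\<lambda>c. fun_upd \<omega> (Suc p) c).
        inj_on (\<lambda>i. snd (\<omega>' (Suc p) i)) {..<N}"
      using m AE_stepM_distinct[OF card_surv_ge(2)[OF inj q \<alpha>]]
      by (subst AE_distr_iff[OF e]) (auto simp: pred_def)
  qed
qed

text \<open>The induction must be general in \<open>h\<close>, since a step replaces
  \<open>h\<close> by \<open>K h + h\<close>. Invariance doubles the integral and selection costs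
  1/\<alpha>, hence the factor 2/\<alpha> per generation.\<close>

lemma nn_integral_gen_le:
  assumes q: "1 \<le> qrank \<alpha> N" and h[measurable]: "h \<in> borel_measurable borel"
  shows "(\<integral>\<^sup>+\<omega>. (\<Sum>i<N. h (fst (\<omega> p i))) \<partial>T N p) \<le> of_nat N * ennreal ((2 / \<alpha>) ^ p) * (\<integral>\<^sup>+x. h x \<partial>\<mu>)"
  using h
proof (induction p arbitrary: h)
  case (0 h)
  note [measurable] = 0
  have m: "(\<lambda>z. h (fst z)) \<in> borel_measurable (\<mu> \<Otimes>\<^sub>M mark)" for z
    by (intro measurable_compose[OF measurable_fst]) auto
  interpret mk: prob_space mark by (rule prob_space_mark)
  have "(\<integral>\<^sup>+\<omega>. (\<Sum>i<N. h (fst (\<omega> 0 i))) \<partial>T N 0) = (\<integral>\<^sup>+c. (\<Sum>i<N. h (fst (c i))) \<partial>init N)"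
    by (rule nn_integral_traj_0) measurable
  also have "\<dots> = (\<Sum>i<N. \<integral>\<^sup>+c. h (fst (c i)) \<partial>init N)"
    by (rule nn_integral_sum) (subst measurable_cong_sets[OF sets_init refl], measurable)
  also have "\<dots> = (\<Sum>i<N. \<integral>\<^sup>+z. h (fst z) \<partial>(\<mu> \<Otimes>\<^sub>M mark))"
    using m prob_space_eta_mark by (intro sum.cong refl nn_integral_PiM_component[where f="\<lambda>z. h (fst z)"]) auto
  also have "(\<integral>\<^sup>+z. h (fst z) \<partial>(\<mu> \<Otimes>\<^sub>M mark)) = (\<integral>\<^sup>+x. h x \<partial>\<mu>)"
    using mk.emeasure_space_1 m by (subst mk.nn_integral_fst[symmetric]) auto
  finally show ?case by simp
next
  case (Suc p h)
  note [measurable] = Suc.prems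
  let ?g = "\<lambda>x. (\<integral>\<^sup>+y. h y \<partial>K (Suc p) x) + h x"
  have Kh: "(\<lambda>x. \<integral>\<^sup>+y. h y \<partial>K (Suc p) x) \<in> borel_measurable borel"
    by (rule measurable_compose[OF K_subprob nn_integral_measurable_subprob_algebra]) measurable
  then have g[measurable]: "?g \<in> borel_measurable borel" by measurable
  have "(\<integral>\<^sup>+\<omega>. (\<Sum>i<N. h (fst (\<omega> (Suc p) i))) \<partial>T N (Suc p))
     = (\<integral>\<^sup>+\<omega>. (\<integral>\<^sup>+c. (\<Sum>i<N. h (fst (c i))) \<partial>stepM S K \<alpha> N p (\<omega> p)) \<partial>T N p)"
    by (rule nn_integral_gen_pair[where h="\<lambda>_ c. \<Sum>i<N. h (fst (c i))"]) measurable
  also have "\<dots> \<le> (\<integral>\<^sup>+\<omega>. ennreal (1 / \<alpha>) * (\<Sum>i<N. ?g (fst (\<omega> p i))) \<partial>T N p)"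
    using AE_traj_distinct[OF q, of p] by (intro nn_integral_mono_AE) (auto elim!: eventually_mono intro!: nn_integral_stepM_le q)
  also have "\<dots> = ennreal (1 / \<alpha>) * (\<integral>\<^sup>+\<omega>. (\<Sum>i<N. ?g (fst (\<omega> p i))) \<partial>T N p)"
  proof (rule nn_integral_cmult)
    have "(\<lambda>c. \<Sum>i<N. ?g (fst (c i))) \<in> borel_measurable (CM N)"
      by (intro borel_measurable_sum measurable_compose[OF _ g] measurable_compose[OF measurable_CM_component measurable_fst])
    from measurable_compose[OF measurable_gen[OF order_refl] this]
    show "(\<lambda>\<omega>. \<Sum>i<N. ?g (fst (\<omega> p i))) \<in> borel_measurable (T N p)"
      by (simp add: measurable_cong_sets[OF sets_traj refl])
  qed
  also have "\<dots> \<le> ennreal (1 / \<alpha>) * (of_nat N * ennreal ((2 / \<alpha>) ^ p) * (\<integral>\<^sup>+x. ?g x \<partial>\<mu>))"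
    by (intro mult_left_mono Suc.IH g) simp
  also have "(\<integral>\<^sup>+x. ?g x \<partial>\<mu>) = 2 * (\<integral>\<^sup>+x. h x \<partial>\<mu>)"
    using Kh by (subst nn_integral_add) (auto simp: nn_integral_K_invariant mult_2)
  also have "ennreal (1 / \<alpha>) * (of_nat N * ennreal ((2 / \<alpha>) ^ p) * (2 * (\<integral>\<^sup>+x. h x \<partial>\<mu>)))
     = of_nat N * (ennreal (2 / \<alpha>) * ennreal ((2 / \<alpha>) ^ p)) * (\<integral>\<^sup>+x. h x \<partial>\<mu>)"
    using \<alpha> ennreal_mult[of 2 "1 / \<alpha>"] by (simp add: ac_simps)
  also have "ennreal (2 / \<alpha>) * ennreal ((2 / \<alpha>) ^ p) = ennreal ((2 / \<alpha>) ^ Suc p)"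
    using \<alpha> by (simp flip: ennreal_mult)
  finally show ?case .
qed

end

section \<open>Levels\<close>

text \<open>An interchange of limits: \<open>k\<close> is fixed first with \<open>\<gamma> k\<close>
  small, and only then does \<open>N\<close> tend to infinity.\<close>

lemma tendsto_sandwich_family:
  fixes a b :: "nat \<Rightarrow> real"
  assumes "\<And>k. eventually (\<lambda>N. \<bar>a N - b N\<bar> \<le> g k N) sequentially"
    and "\<And>k::nat. g k \<longlonglongrightarrow> \<gamma> k" and "\<gamma> \<longlonglongrightarrow> 0" and "b \<longlonglongrightarrow> l"
  shows "a \<longlonglongrightarrow> l"
proof -
  have "(\<lambda>N. a N - b N) \<longlonglongrightarrow> 0"
  proof (rule tendstoI)
    fix e :: real assume "0 < e"
    then have "eventually (\<lambda>k. \<gamma> k < e) sequentially" using assms(3) by (intro order_tendstoD(2))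
    then obtain k where "\<gamma> k < e" by (auto simp: eventually_sequentially)
    then have "eventually (\<lambda>N. g k N < e) sequentially" using assms(2) by (intro order_tendstoD(2))
    with assms(1)[of k] show "eventually (\<lambda>N. dist (a N - b N) 0 < e) sequentially"
      by eventually_elim (simp add: dist_real_def)
  qed
  from tendsto_add[OF this assms(4)] show ?thesis by simp
qed

text \<open>The form in which the density of the score enters: no atoms make the distribution
  function hit each target exactly, and positive mass on both sides of a level makes the quantile
  unique.\<close>

locale splitting_levels = splitting S K \<alpha> \<eta>
  for S :: "'a::euclidean_space \<Rightarrow> real" and K \<alpha> \<eta> +
  fixes n :: nat
  assumes atomless: "\<And>s. measure (etaM \<eta>) {x. S x = s} = 0"
    and mass_below: "\<And>p a. p \<le> n \<Longrightarrow> a < Lq \<eta> S \<alpha> p \<Longrightarrow> 0 < measure (etaM \<eta>) {x. a < S x \<and> S x < Lq \<eta> S \<alpha> p}"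
    and mass_above: "\<And>p b. p \<le> n \<Longrightarrow> Lq \<eta> S \<alpha> p < b \<Longrightarrow> 0 < measure (etaM \<eta>) {x. Lq \<eta> S \<alpha> p < S x \<and> S x < b}"
begin

abbreviation "lev p \<equiv> Lq \<eta> S \<alpha> p"
abbreviation "F \<equiv> cdfY \<eta> S"

lemma cdfY_eq_cdf: "F = cdf (distr \<mu> borel S)"
proof
  fix s
  have "measure (distr \<mu> borel S) {..s} = measure \<mu> (S -` {..s} \<inter> space \<mu>)"
    by (rule measure_distr) auto
  then show "F s = cdf (distr \<mu> borel S) s"
    unfolding cdfY_def cdf_def by (simp add: vimage_def)
qed

text \<open>Without atoms the distribution function is continuous. The infimum is then attained,
  giving one inequality; the other follows by monotonicity from a point \<open>c\<close>, supplied
  by the intermediate value theorem, where the target is hit exactly.\<close>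

lemma cdfY_lev: "F (lev p) = 1 - \<alpha> ^ Suc p"
proof -
  interpret D: real_distribution "distr \<mu> borel S" by (rule real_distribution_distr) simp
  let ?t = "1 - \<alpha> ^ Suc p"
  have t: "0 < ?t" "?t < 1" using \<alpha> by (simp_all add: power_Suc_less_one del: power_Suc)
  have "measure (distr \<mu> borel S) {s} = measure \<mu> (S -` {s} \<inter> space \<mu>)" for s
    by (rule measure_distr) auto
  then have cont: "isCont F s" for s
    unfolding cdfY_eq_cdf D.isCont_cdf using atomless[of s] by (simp add: vimage_def)
  have mono: "F x \<le> F y" if "x \<le> y" for x y
    unfolding cdfY_eq_cdf using that by (rule D.cdf_nondecreasing)
  have "eventually (\<lambda>s. F s < ?t) at_bot"
    unfolding cdfY_eq_cdf using D.cdf_lim_at_bot t by (intro order_tendstoD(2))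
  then obtain a where a: "F a < ?t" by (auto simp: eventually_at_bot_linorder)
  have "eventually (\<lambda>s. ?t < F s) at_top"
    unfolding cdfY_eq_cdf using D.cdf_lim_at_top_prob t by (intro order_tendstoD(1))
  then obtain b where b: "?t < F b" by (auto simp: eventually_at_top_linorder)
  have "a \<le> b" using mono[of b a] a b by linarith
  then obtain c where c: "F c = ?t" using IVT[of F a ?t b] a b cont by auto
  let ?X = "{s. ?t \<le> F s}"
  have bdd: "bdd_below ?X"
  proof (rule bdd_belowI[of _ a])
    fix s assume "s \<in> ?X"
    then show "a \<le> s" using mono[of s a] a by (cases "s \<le> a") auto
  qed
  have "closed ?X" using cont by (intro closed_Collect_le continuous_intros continuous_at_imp_continuous_on) auto
  moreover have "c \<in> ?X" using c by simp
  then have "?X \<noteq> {}" by blast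
  ultimately have "Inf ?X \<in> ?X" using closed_contains_Inf[OF _ bdd] by blast
  moreover have "Inf ?X \<le> c" using bdd c by (intro cInf_lower) auto
  ultimately show ?thesis using mono[of "Inf ?X" c] c unfolding Lq_def by auto
qed

lemma measure_ge_lev: "measure \<mu> {x. lev p \<le> S x} = \<alpha> ^ Suc p"
proof -
  have "measure \<mu> {x. S x \<le> lev p} = measure \<mu> ({x. S x < lev p} \<union> {x. S x = lev p})"
    by (rule arg_cong[where f="measure \<mu>"]) auto
  also have "\<dots> = measure \<mu> {x. S x < lev p} + measure \<mu> {x. S x = lev p}"
    by (rule finite_measure_Union) auto
  finally have "measure \<mu> {x. S x < lev p} = 1 - \<alpha> ^ Suc p"
    using cdfY_lev[of p] atomless[of "lev p"] unfolding cdfY_def by simp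
  moreover have "{x. lev p \<le> S x} = space \<mu> - {x. S x < lev p}" by auto
  ultimately show ?thesis using prob_compl[of "{x. S x < lev p}"] by simp
qed

lemma lev_strict_mono: "lev p < lev (Suc p)"
proof (rule ccontr)
  assume "\<not> lev p < lev (Suc p)"
  then have "measure \<mu> {x. lev p \<le> S x} \<le> measure \<mu> {x. lev (Suc p) \<le> S x}"
    by (intro finite_measure_mono) auto
  then show False unfolding measure_ge_lev using \<alpha> by simp
qed

definition region :: "nat \<Rightarrow> 'a set" where
  "region p = (if p = 0 then UNIV else {x. lev (p - 1) \<le> S x})"

lemma region_measurable [measurable]: "region p \<in> sets borel"
  unfolding region_def by simp

lemma measure_region: "measure \<mu> (region p) = \<alpha> ^ p"
  unfolding region_def using measure_ge_lev[of "p - 1"] prob_space by (cases p) auto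

lemma region_Suc: "region (Suc p) = {x. lev p \<le> S x}"
  unfolding region_def by simp

lemma region_Suc_subset: "{x. lev p \<le> S x} \<subseteq> region p"
  unfolding region_def using lev_strict_mono[of "p - 1"] by auto

lemma etap_eq: "etap \<eta> S \<alpha> p f = (1 / \<alpha> ^ p) * (\<integral>x. indicator (region p) x * f x \<partial>\<mu>)"
  unfolding etap_def region_def by auto

lemma etap_indicator:
  assumes [measurable]: "A \<in> sets borel"
  shows "etap \<eta> S \<alpha> p (indicator A) = measure \<mu> (region p \<inter> A) / \<alpha> ^ p"
proof -
  have "(\<integral>x. indicator (region p) x * indicator A x \<partial>\<mu>) = (\<integral>x. (indicator (region p \<inter> A) x :: real) \<partial>\<mu>)"
    by (intro Bochner_Integration.integral_cong) (auto simp: indicator_def)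
  then show ?thesis unfolding etap_eq by simp
qed

lemma measure_region_split:
  "measure \<mu> (region p \<inter> {x. S x \<le> s}) = \<alpha> ^ p - measure \<mu> (region p \<inter> {x. s < S x})"
proof -
  have "measure \<mu> (region p) = measure \<mu> ((region p \<inter> {x. S x \<le> s}) \<union> (region p \<inter> {x. s < S x}))"
    by (rule arg_cong[where f="measure \<mu>"]) auto
  also have "\<dots> = measure \<mu> (region p \<inter> {x. S x \<le> s}) + measure \<mu> (region p \<inter> {x. s < S x})"
    by (rule finite_measure_Union) auto
  finally show ?thesis by (simp add: measure_region)
qed

lemma etap_below_lev:
  assumes p: "p \<le> n" and s: "s < lev p"
  shows "etap \<eta> S \<alpha> p (indicator {x. S x \<le> s}) < 1 - \<alpha>"
proof -
  \<comment> \<open>The strip between \<open>t\<close> and \<open>lev p\<close> must lie both above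
    \<open>s\<close> and inside \<open>region p\<close>, hence the maximum with the previous level;
    generation 0 has no previous level.\<close>
  define t where "t = (if p = 0 then s else max s (lev (p - 1)))"
  have t: "t < lev p" unfolding t_def using s lev_strict_mono[of "p - 1"] by auto
  have "measure \<mu> {x. lev p \<le> S x} + measure \<mu> {x. t < S x \<and> S x < lev p}
     = measure \<mu> ({x. lev p \<le> S x} \<union> {x. t < S x \<and> S x < lev p})"
    by (rule finite_measure_Union[symmetric]) auto
  also have "\<dots> \<le> measure \<mu> (region p \<inter> {x. s < S x})"
    using s lev_strict_mono[of "p - 1"]
    by (intro finite_measure_mono) (auto simp: region_def t_def split: if_splits)
  finally have "\<alpha> ^ Suc p < measure \<mu> (region p \<inter> {x. s < S x})"
    using mass_below[OF p t] unfolding measure_ge_lev by linarith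
  then have "measure \<mu> (region p \<inter> {x. S x \<le> s}) < (1 - \<alpha>) * \<alpha> ^ p"
    unfolding measure_region_split by (simp add: algebra_simps)
  then show ?thesis using \<alpha> by (simp add: etap_indicator divide_less_eq)
qed

lemma etap_above_lev:
  assumes p: "p \<le> n" and s: "lev p < s"
  shows "1 - \<alpha> < etap \<eta> S \<alpha> p (indicator {x. S x \<le> s})"
proof -
  have "measure \<mu> (region p \<inter> {x. s < S x}) + measure \<mu> {x. lev p < S x \<and> S x < s}
     = measure \<mu> (region p \<inter> {x. s < S x} \<union> {x. lev p < S x \<and> S x < s})"
    by (rule finite_measure_Union[symmetric]) auto
  also have "\<dots> \<le> measure \<mu> {x. lev p \<le> S x}"
    using s by (intro finite_measure_mono) auto
  finally have "measure \<mu> (region p \<inter> {x. s < S x}) < \<alpha> ^ Suc p"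
    using mass_above[OF p s] unfolding measure_ge_lev by linarith
  then have "(1 - \<alpha>) * \<alpha> ^ p < measure \<mu> (region p \<inter> {x. S x \<le> s})"
    unfolding measure_region_split by (simp add: algebra_simps)
  then show ?thesis using \<alpha> by (simp add: etap_indicator less_divide_eq)
qed

text \<open>The limit recursion, with selection giving the factor 1/\<alpha>. Since the level sets
  are nested, the integral reduces to one over the higher set, where the mutation leaves \<eta>
  invariant.\<close>

lemma etap_Suc:
  assumes [measurable]: "f \<in> borel_measurable borel" and B: "\<And>x. \<bar>f x\<bar> \<le> B"
  shows "etap \<eta> S \<alpha> (Suc p) f = (1 / \<alpha>) * etap \<eta> S \<alpha> p (\<lambda>x. indicator {x. lev p \<le> S x} x * move p (lev p) f x)"
proof -
  have "(\<integral>x. indicator (region p) x * (indicator {x. lev p \<le> S x} x * move p (lev p) f x) \<partial>\<mu>)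
     = (\<integral>x. indicator {x. lev p \<le> S x} x * move p (lev p) f x \<partial>\<mu>)"
    using region_Suc_subset[of p] by (intro Bochner_Integration.integral_cong) (auto simp: indicator_def)
  also have "\<dots> = (\<integral>x. indicator {x. lev p \<le> S x} x * f x \<partial>\<mu>)"
    by (rule integral_move[OF assms])
  finally show ?thesis unfolding etap_eq region_Suc using \<alpha> by (simp add: field_simps)
qed

text \<open>Dominates the change of \<open>x \<mapsto> indicator {L \<le> S x} * move p L f x\<close> when \<open>L\<close> varies
  by at most \<open>d\<close> around \<open>lev p\<close>, uniformly in \<open>f\<close> with \<open>\<bar>f\<bar> \<le> B\<close>.\<close>
definition wobble :: "nat \<Rightarrow> real \<Rightarrow> real \<Rightarrow> 'a \<Rightarrow> real" where
  "wobble p B d x = 2 * B * (indicator {x. \<bar>S x - lev p\<bar> \<le> d} x + measure (K (Suc p) x) {y. \<bar>S y - lev p\<bar> \<le> d})"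

lemma wobble_measurable [measurable]: "wobble p B d \<in> borel_measurable borel"
proof -
  have "(\<lambda>x. measure (K (Suc p) x) {y. \<bar>S y - lev p\<bar> \<le> d}) \<in> borel_measurable borel"
    by (rule measurable_compose[OF K_subprob measurable_measure_subprob_algebra]) measurable
  then show ?thesis unfolding wobble_def[abs_def] by measurable
qed

lemma wobble_bounds:
  assumes "0 \<le> B"
  shows "0 \<le> wobble p B d x" "\<bar>wobble p B d x\<bar> \<le> 4 * B"
proof -
  have "0 \<le> measure (K (Suc p) x) {y. \<bar>S y - lev p\<bar> \<le> d}" "measure (K (Suc p) x) {y. \<bar>S y - lev p\<bar> \<le> d} \<le> 1"
    using prob_space.prob_le_1[OF prob_space_K] by auto
  then have *: "0 \<le> indicator {x. \<bar>S x - lev p\<bar> \<le> d} x + measure (K (Suc p) x) {y. \<bar>S y - lev p\<bar> \<le> d}"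
    "indicator {x. \<bar>S x - lev p\<bar> \<le> d} x + measure (K (Suc p) x) {y. \<bar>S y - lev p\<bar> \<le> d} \<le> 2"
    by (auto simp: indicator_def)
  show "0 \<le> wobble p B d x" unfolding wobble_def using *(1) assms by simp
  moreover have "wobble p B d x \<le> 2 * B * 2" unfolding wobble_def using * assms by (intro mult_left_mono) auto
  ultimately show "\<bar>wobble p B d x\<bar> \<le> 4 * B" by simp
qed

text \<open>By \<open>\<eta> K = \<eta>\<close> the kernel term has the same mean as the indicator
  term, so \<open>2 * B\<close> is counted twice.\<close>

lemma integral_wobble:
  "(\<integral>x. wobble p B d x \<partial>\<mu>) = 4 * B * measure \<mu> {x. \<bar>S x - lev p\<bar> \<le> d}"
proof -
  let ?A = "{x. \<bar>S x - lev p\<bar> \<le> d}"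
  have [measurable]: "(\<lambda>x. measure (K (Suc p) x) ?A) \<in> borel_measurable borel"
    by (rule measurable_compose[OF K_subprob measurable_measure_subprob_algebra]) measurable
  have "(\<integral>x. indicator UNIV x * (\<integral>y. indicator ?A y \<partial>K (Suc p) x) \<partial>\<mu>)
      = (\<integral>x. measure (K (Suc p) x) UNIV * indicator ?A x \<partial>\<mu>)"
    by (rule integral_reversible[where B=1]) (auto simp: indicator_def)
  then have "(\<integral>x. measure (K (Suc p) x) ?A \<partial>\<mu>) = measure \<mu> ?A"
    using prob_space.prob_space[OF prob_space_K, of p] by simp
  moreover have "integrable \<mu> (\<lambda>x. measure (K (Suc p) x) ?A)"
    using prob_space.prob_le_1[OF prob_space_K] by (intro integrable_const_bound[where B=1]) auto
  moreover have "integrable \<mu> (indicator ?A :: _ \<Rightarrow> real)" by (simp add: emeasure_eq_measure)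
  ultimately have "(\<integral>x. indicator ?A x + measure (K (Suc p) x) ?A \<partial>\<mu>) = measure \<mu> ?A + measure \<mu> ?A"
    by (subst Bochner_Integration.integral_add) auto
  then show ?thesis unfolding wobble_def by simp
qed

lemma measure_near_lev_tendsto: "(\<lambda>k. measure \<mu> {x. \<bar>S x - s\<bar> \<le> 1 / Suc k}) \<longlonglongrightarrow> 0"
proof -
  have "(\<lambda>k. measure \<mu> {x. \<bar>S x - s\<bar> \<le> 1 / Suc k}) \<longlonglongrightarrow> measure \<mu> (\<Inter>k::nat. {x. \<bar>S x - s\<bar> \<le> 1 / Suc k})"
  proof (rule finite_Lim_measure_decseq)
    show "decseq (\<lambda>k::nat. {x. \<bar>S x - s\<bar> \<le> 1 / Suc k})"
    proof (rule decseq_SucI, safe)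
      fix k x assume "\<bar>S x - s\<bar> \<le> 1 / Suc (Suc k)"
      also have "1 / Suc (Suc k) \<le> 1 / real (Suc k)" by (intro divide_left_mono) auto
      finally show "\<bar>S x - s\<bar> \<le> 1 / Suc k" by simp
    qed
  qed auto
  also have "(\<Inter>k::nat. {x. \<bar>S x - s\<bar> \<le> 1 / Suc k}) = {x. S x = s}"
  proof safe
    fix x assume *: "x \<in> (\<Inter>k::nat. {x. \<bar>S x - s\<bar> \<le> 1 / Suc k})"
    show "S x = s"
    proof (rule ccontr)
      assume "S x \<noteq> s"
      then obtain k :: nat where "1 / Suc k < \<bar>S x - s\<bar>" using nat_approx_posE[of "\<bar>S x - s\<bar>"] by auto
      moreover have "\<bar>S x - s\<bar> \<le> 1 / Suc k" using * by auto
      ultimately show False by linarith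
    qed
  qed auto
  finally show ?thesis using atomless by simp
qed

lemma etap_wobble_tendsto:
  assumes B: "0 \<le> B"
  shows "(\<lambda>k. etap \<eta> S \<alpha> p (wobble p B (1 / Suc k))) \<longlonglongrightarrow> 0"
proof (rule tendsto_sandwich[where f="\<lambda>_. 0" and h="\<lambda>k. (1 / \<alpha> ^ p) * (4 * B * measure \<mu> {x. \<bar>S x - lev p\<bar> \<le> 1 / Suc k})"])
  have i: "integrable \<mu> (wobble p B d)" "integrable \<mu> (\<lambda>x. indicator (region p) x * wobble p B d x)" for d
    using wobble_bounds[OF B, of p d] B
    by (auto intro!: integrable_bounded_prob[OF prob_space_axioms, where B="4 * B"] simp: indicator_def)
  have "0 \<le> (\<integral>x. indicator (region p) x * wobble p B d x \<partial>\<mu>)" for d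
    using wobble_bounds(1)[OF B] by (intro integral_nonneg_AE) auto
  then show "eventually (\<lambda>k. 0 \<le> etap \<eta> S \<alpha> p (wobble p B (1 / Suc k))) sequentially"
    unfolding etap_eq using \<alpha> by (intro always_eventually allI mult_nonneg_nonneg) auto
  have "(\<integral>x. indicator (region p) x * wobble p B d x \<partial>\<mu>) \<le> (\<integral>x. wobble p B d x \<partial>\<mu>)" for d
    using i wobble_bounds(1)[OF B, of p d] by (intro integral_mono) (auto simp: indicator_def)
  then show "eventually (\<lambda>k. etap \<eta> S \<alpha> p (wobble p B (1 / Suc k))
      \<le> (1 / \<alpha> ^ p) * (4 * B * measure \<mu> {x. \<bar>S x - lev p\<bar> \<le> 1 / Suc k})) sequentially"
    unfolding etap_eq using \<alpha> by (intro always_eventually allI mult_left_mono) (auto simp: integral_wobble)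
  show "(\<lambda>k. (1 / \<alpha> ^ p) * (4 * B * measure \<mu> {x. \<bar>S x - lev p\<bar> \<le> 1 / Suc k})) \<longlonglongrightarrow> 0"
    by (intro tendsto_mult_right_zero measure_near_lev_tendsto)
qed simp

section \<open>The conditional mean at the random level\<close>

definition step_mean :: "nat \<Rightarrow> nat \<Rightarrow> (nat \<Rightarrow> 'a \<times> real) \<Rightarrow> ('a \<Rightarrow> real) \<Rightarrow> real" where
  "step_mean p N c f = (\<integral>z. f (fst z) \<partial>partM S K \<alpha> N p c 0)"

text \<open>Deterministic: the hypotheses describe one realization of all the systems, and
  probability enters only when they are shown to hold almost surely.\<close>

lemma step_mean_tendsto:
  assumes f[measurable]: "f \<in> borel_measurable borel" and B: "\<And>x. \<bar>f x\<bar> \<le> B"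
    and inj: "eventually (\<lambda>N. inj_on (\<lambda>i. snd (c N i)) {..<N}) sequentially"
    and lev: "(\<lambda>N. qlev S \<alpha> N (c N)) \<longlonglongrightarrow> lev p"
    and main: "(\<lambda>N. emp N (c N) (\<lambda>x. indicator {x. lev p \<le> S x} x * move p (lev p) f x))
       \<longlonglongrightarrow> etap \<eta> S \<alpha> p (\<lambda>x. indicator {x. lev p \<le> S x} x * move p (lev p) f x)"
    and wob: "\<And>k::nat. (\<lambda>N. emp N (c N) (wobble p B (1 / Suc k))) \<longlonglongrightarrow> etap \<eta> S \<alpha> p (wobble p B (1 / Suc k))"
  shows "(\<lambda>N. step_mean p N (c N) f) \<longlonglongrightarrow> etap \<eta> S \<alpha> (Suc p) f"
proof -
  have B0: "0 \<le> B" using B[of undefined] by linarith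
  let ?G = "\<lambda>x. indicator {x. lev p \<le> S x} x * move p (lev p) f x"
  \<comment> \<open>Normalising by \<open>N\<close> instead of the number of survivors lets both
    averages run over all particles, so that they can be compared term by term. The ratio is
    restored afterwards.\<close>
  define a where "a N = (\<Sum>j<N. indicator (surv S \<alpha> N (c N)) j * move p (qlev S \<alpha> N (c N)) f (fst (c N j))) / real N" for N
  have "a \<longlonglongrightarrow> etap \<eta> S \<alpha> p ?G"
  proof (rule tendsto_sandwich_family[OF _ wob etap_wobble_tendsto[OF B0] main])
    fix k :: nat
    have "eventually (\<lambda>N. dist (qlev S \<alpha> N (c N)) (lev p) < 1 / Suc k) sequentially"
      using lev by (rule tendstoD) simp
    then show "eventually (\<lambda>N. \<bar>a N - emp N (c N) ?G\<bar> \<le> emp N (c N) (wobble p B (1 / Suc k))) sequentially"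
    proof eventually_elim
      case (elim N)
      let ?l = "qlev S \<alpha> N (c N)" and ?A = "surv S \<alpha> N (c N)"
      have l: "\<bar>?l - lev p\<bar> \<le> 1 / Suc k" using elim by (simp add: dist_real_def)
      have "\<bar>indicator ?A j * move p ?l f (fst (c N j)) - ?G (fst (c N j))\<bar> \<le> wobble p B (1 / Suc k) (fst (c N j))"
        if j: "j < N" for j
      proof -
        let ?x = "fst (c N j)"
        have K0: "0 \<le> 2 * B * measure (K (Suc p) ?x) {y. \<bar>S y - lev p\<bar> \<le> 1 / Suc k}" using B0 by simp
        show ?thesis
        proof (cases "\<bar>S ?x - lev p\<bar> \<le> 1 / Suc k")
          \<comment> \<open>Inside the band survival is undecided, but both terms are at most
            \<open>B\<close> in absolute value and the indicator in \<open>wobble\<close> already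
            pays \<open>2 * B\<close>.\<close>
          case True
          then have "2 * B \<le> wobble p B (1 / Suc k) ?x"
            unfolding wobble_def using K0 by (simp add: algebra_simps)
          moreover have "\<bar>indicator ?A j * move p ?l f ?x\<bar> \<le> B" "\<bar>?G ?x\<bar> \<le> B"
            using abs_move_le[OF f B] B0 by (auto simp: indicator_def)
          ultimately show ?thesis by linarith
        next
          \<comment> \<open>Outside the band the score lies on the same side of the empirical level
            and of \<open>lev p\<close>, strictly, so ties do not matter and survival equals
            membership in the level set. Only the kernel term remains.\<close>
          case False
          then have "j \<in> ?A \<longleftrightarrow> lev p \<le> S ?x"
            using surv_level(1)[of S \<alpha> N "c N" j] surv_level(2)[of j S \<alpha> N "c N"] l j by auto
          then have "\<bar>indicator ?A j * move p ?l f ?x - ?G ?x\<bar> \<le> \<bar>move p ?l f ?x - move p (lev p) f ?x\<bar>"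
            by (auto simp: indicator_def)
          also have "\<dots> \<le> 2 * B * measure (K (Suc p) ?x) {y. \<bar>S y - lev p\<bar> \<le> 1 / Suc k}"
            by (rule abs_move_diff_le[OF f B l])
          also have "\<dots> = wobble p B (1 / Suc k) ?x" using False unfolding wobble_def by simp
          finally show ?thesis .
        qed
      qed
      then have "\<bar>(\<Sum>j<N. indicator ?A j * move p ?l f (fst (c N j)) - ?G (fst (c N j)))\<bar> \<le> (\<Sum>j<N. wobble p B (1 / Suc k) (fst (c N j)))"
        by (intro order_trans[OF sum_abs] sum_mono) auto
      then have "\<bar>(\<Sum>j<N. indicator ?A j * move p ?l f (fst (c N j)) - ?G (fst (c N j))) / real N\<bar> \<le> (\<Sum>j<N. wobble p B (1 / Suc k) (fst (c N j))) / real N"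
        by (simp add: abs_divide divide_right_mono)
      then show ?case unfolding a_def emp_def by (simp only: sum_subtractf diff_divide_distrib)
    qed
  qed
  moreover have "(\<lambda>N. real N / real (N - qrank \<alpha> N)) \<longlonglongrightarrow> 1 / \<alpha>"
  proof -
    have "(\<lambda>N. real (N - qrank \<alpha> N) / real N) \<longlonglongrightarrow> \<alpha>"
    proof (rule tendsto_sandwich[where f="\<lambda>_. \<alpha>" and h="\<lambda>N. \<alpha> + 1 / real N"])
      have *: "\<alpha> \<le> real (N - qrank \<alpha> N) / real N \<and> real (N - qrank \<alpha> N) / real N \<le> \<alpha> + 1 / real N" if "0 < N" for N
      proof
        have r: "real (N - qrank \<alpha> N) = real N - real (qrank \<alpha> N)"
          using qrank_le[OF \<alpha>(1), of N] by (simp add: of_nat_diff)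
        show "\<alpha> \<le> real (N - qrank \<alpha> N) / real N"
          using that qrank_bounds(1)[OF \<alpha>, of N] unfolding r by (simp add: field_simps)
        have "real N - real (qrank \<alpha> N) \<le> real N * \<alpha> + 1"
          using qrank_bounds(2)[OF \<alpha>, of N] by (simp add: algebra_simps)
        then have "real (N - qrank \<alpha> N) / real N \<le> (real N * \<alpha> + 1) / real N"
          unfolding r by (rule divide_right_mono) simp
        also have "\<dots> = \<alpha> + 1 / real N" using that by (simp add: add_divide_distrib)
        finally show "real (N - qrank \<alpha> N) / real N \<le> \<alpha> + 1 / real N" .
      qed
      show "eventually (\<lambda>N. \<alpha> \<le> real (N - qrank \<alpha> N) / real N) sequentially"
        using * by (intro eventually_mono[OF eventually_gt_at_top[of "0::nat"]]) auto
      show "eventually (\<lambda>N. real (N - qrank \<alpha> N) / real N \<le> \<alpha> + 1 / real N) sequentially"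
        using * by (intro eventually_mono[OF eventually_gt_at_top[of "0::nat"]]) auto
      show "(\<lambda>N. \<alpha> + 1 / real N) \<longlonglongrightarrow> \<alpha>"
        using tendsto_add[OF tendsto_const lim_1_over_n, of \<alpha>] by simp
    qed simp
    then have "(\<lambda>N. 1 / (real (N - qrank \<alpha> N) / real N)) \<longlonglongrightarrow> 1 / \<alpha>"
      using \<alpha> by (intro tendsto_divide tendsto_const) auto
    then show ?thesis by simp
  qed
  ultimately have "(\<lambda>N. real N / real (N - qrank \<alpha> N) * a N) \<longlonglongrightarrow> 1 / \<alpha> * etap \<eta> S \<alpha> p ?G"
    by (intro tendsto_mult)
  moreover have "eventually (\<lambda>N. real N / real (N - qrank \<alpha> N) * a N = step_mean p N (c N) f) sequentially"
    using inj eventually_qrank_ge_1[OF \<alpha>]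
  proof eventually_elim
    case (elim N)
    have ne: "surv S \<alpha> N (c N) \<noteq> {}" using card_surv_ge(2)[OF elim \<alpha>] .
    have N: "0 < N" using elim(2) qrank_le[OF \<alpha>(1), of N] by simp
    have "(\<Sum>j<N. indicator (surv S \<alpha> N (c N)) j * move p (qlev S \<alpha> N (c N)) f (fst (c N j)))
       = (\<Sum>j\<in>surv S \<alpha> N (c N). move p (qlev S \<alpha> N (c N)) f (fst (c N j)))"
      using surv_subset[of S \<alpha> N "c N"] by (intro sum.mono_neutral_cong_right) auto
    then show ?case
      unfolding a_def step_mean_def integral_partM[OF f B ne] card_surv[OF elim \<alpha>(1)] using N by simp
  qed
  ultimately have "(\<lambda>N. step_mean p N (c N) f) \<longlonglongrightarrow> 1 / \<alpha> * etap \<eta> S \<alpha> p ?G"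
    by (rule Lim_transform_eventually)
  then show ?thesis unfolding etap_Suc[OF f B] .
qed

end

section \<open>Law of large numbers for bounded functions\<close>

lemma nn_integral_indicator_vimage:
  assumes "g \<in> M \<rightarrow>\<^sub>M N" "D \<in> sets N"
  shows "(\<integral>\<^sup>+x. indicator D (g x) \<partial>M) = emeasure M (g -` D \<inter> space M)"
  unfolding nn_integral_indicator[OF measurable_sets[OF assms], symmetric]
  by (intro nn_integral_cong) (auto simp: indicator_def)

text \<open>Borel--Cantelli for each tolerance 1/(k+1), followed by a countable intersection. It
  uses no information on the joint law of the \<open>X N\<close>.\<close>

lemma (in prob_space) AE_tendsto_0_exp_concentration:
  fixes X :: "nat \<Rightarrow> 'a \<Rightarrow> real"
  assumes C: "0 < C"
    and X: "eventually (\<lambda>N. X N \<in> borel_measurable M \<and>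
      (\<forall>e>0. prob {\<omega> \<in> space M. e \<le> \<bar>X N \<omega>\<bar>} \<le> 2 * exp (- (e\<^sup>2 / C) * real N))) sequentially"
  shows "AE \<omega> in M. (\<lambda>N. X N \<omega>) \<longlonglongrightarrow> 0"
proof -
  obtain N0 where N0: "\<And>N. N0 \<le> N \<Longrightarrow> X N \<in> borel_measurable M"
    "\<And>N e. N0 \<le> N \<Longrightarrow> 0 < e \<Longrightarrow> prob {\<omega> \<in> space M. e \<le> \<bar>X N \<omega>\<bar>} \<le> 2 * exp (- (e\<^sup>2 / C) * real N)"
    using X by (auto simp: eventually_sequentially)
  have "AE \<omega> in M. eventually (\<lambda>N. \<bar>X N \<omega>\<bar> < e) sequentially" if e: "0 < e" for e
  proof -
    \<comment> \<open>Empty sets fill the initial range, where neither measurability nor the tail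
      bound is available.\<close>
    define A where "A N = (if N0 \<le> N then {\<omega> \<in> space M. e \<le> \<bar>X N \<omega>\<bar>} else {})" for N
    have "summable (\<lambda>N. 2 * exp (- (e\<^sup>2 / C)) ^ N)"
      using e C by (intro summable_mult summable_geometric) simp
    moreover have "prob (A N) \<le> 2 * exp (- (e\<^sup>2 / C)) ^ N" for N
    proof (cases "N0 \<le> N")
      case True
      have "prob (A N) \<le> 2 * exp (- (e\<^sup>2 / C) * real N)" using N0(2)[OF True e] True unfolding A_def by (simp only: if_True)
      also have "exp (- (e\<^sup>2 / C) * real N) = exp (- (e\<^sup>2 / C)) ^ N"
        by (simp only: exp_of_nat2_mult)
      finally show ?thesis .
    qed (simp add: A_def)
    then have "norm (prob (A N)) \<le> 2 * exp (- (e\<^sup>2 / C)) ^ N" for N by simp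
    ultimately have "summable (\<lambda>N. prob (A N))" by (rule summable_comparison_test')
    moreover have "A N \<in> sets M" for N
      unfolding A_def using N0(1) by auto
    ultimately have "AE \<omega> in M. eventually (\<lambda>N. \<omega> \<in> space M - A N) sequentially"
      by (intro borel_cantelli_AE1) (auto simp: emeasure_eq_measure)
    then show ?thesis
    proof eventually_elim
      case (elim \<omega>)
      then show ?case
        using eventually_ge_at_top[of N0] by eventually_elim (auto simp: A_def)
    qed
  qed
  then have "AE \<omega> in M. \<forall>k. eventually (\<lambda>N. \<bar>X N \<omega>\<bar> < 1 / Suc k) sequentially"
    by (subst AE_all_countable) simp
  then show ?thesis
  proof eventually_elim
    case (elim \<omega>)
    show ?case
    proof (rule tendstoI)
      fix e :: real assume "0 < e"
      then obtain k :: nat where k: "1 / Suc k < e" using nat_approx_posE by blast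
      show "eventually (\<lambda>N. dist (X N \<omega>) 0 < e) sequentially"
        using elim[rule_format, of k] by eventually_elim (use k in \<open>auto simp: dist_real_def\<close>)
    qed
  qed
qed

text \<open>A common space is needed for almost sure statements in \<open>N\<close>. Only the law of
  each \<open>\<xi> N\<close> is prescribed, so the coupling between different \<open>N\<close> is
  arbitrary.\<close>

locale splitting_sample = splitting_levels S K \<alpha> \<eta> n
  for S :: "'a::euclidean_space \<Rightarrow> real" and K \<alpha> \<eta> n +
  fixes \<Omega> :: "'w measure" and \<xi> :: "nat \<Rightarrow> 'w \<Rightarrow> nat \<Rightarrow> nat \<Rightarrow> 'a \<times> real"
  assumes prob_space_Omega: "prob_space \<Omega>"
    and xi_measurable: "\<And>N. 1 \<le> qrank \<alpha> N \<Longrightarrow> \<xi> N \<in> \<Omega> \<rightarrow>\<^sub>M PiM {..n} (\<lambda>_. CM N)"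
    and xi_law: "\<And>N. 1 \<le> qrank \<alpha> N \<Longrightarrow> distr \<Omega> (PiM {..n} (\<lambda>_. CM N)) (\<xi> N) = traj \<eta> S K \<alpha> N n"
begin

sublocale O: prob_space \<Omega> by (rule prob_space_Omega)

lemma xi_gen_measurable:
  "1 \<le> qrank \<alpha> N \<Longrightarrow> p \<le> n \<Longrightarrow> (\<lambda>\<omega>. \<xi> N \<omega> p) \<in> \<Omega> \<rightarrow>\<^sub>M CM N"
  by (rule measurable_compose[OF xi_measurable measurable_gen])

lemma nn_integral_xi:
  assumes "1 \<le> qrank \<alpha> N" "h \<in> borel_measurable (PiM {..n} (\<lambda>_. CM N))"
  shows "(\<integral>\<^sup>+\<omega>. h (\<xi> N \<omega>) \<partial>\<Omega>) = (\<integral>\<^sup>+\<omega>. h \<omega> \<partial>T N n)"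
  using nn_integral_distr[OF xi_measurable[OF assms(1)], of h] assms(2) unfolding xi_law[OF assms(1)]
  by (simp only: measurable_cong_sets[OF sets_traj refl])

lemma AE_xi_distinct:
  assumes p: "p \<le> n"
  shows "AE \<omega> in \<Omega>. eventually (\<lambda>N. inj_on (\<lambda>i. snd (\<xi> N \<omega> p i)) {..<N}) sequentially"
proof -
  have "AE \<omega> in \<Omega>. 1 \<le> qrank \<alpha> N \<longrightarrow> inj_on (\<lambda>i. snd (\<xi> N \<omega> p i)) {..<N}" for N
  proof (cases "1 \<le> qrank \<alpha> N")
    case True
    define D where "D = {c \<in> space (CM N :: (nat \<Rightarrow> 'a \<times> real) measure). \<not> inj_on (\<lambda>i. snd (c i)) {..<N}}"
    have D: "D \<in> sets (CM N)" unfolding D_def by measurable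
    have "(\<integral>\<^sup>+\<omega>. indicator D (\<xi> N \<omega> p) \<partial>\<Omega>) = (\<integral>\<^sup>+\<omega>. indicator D (\<omega> p) \<partial>T N n)"
      using D by (intro nn_integral_xi[OF True] measurable_compose[OF measurable_gen[OF p]]) auto
    also have "\<dots> = (\<integral>\<^sup>+\<omega>. indicator D (\<omega> p) \<partial>T N p)" using D by (intro nn_integral_gen p) auto
    also have "\<dots> = (\<integral>\<^sup>+\<omega>. 0 \<partial>T N p)"
      using AE_traj_distinct[OF True, of p] by (intro nn_integral_cong_AE) (auto elim!: eventually_mono simp: D_def)
    finally have "(\<integral>\<^sup>+\<omega>. indicator D (\<xi> N \<omega> p) \<partial>\<Omega>) = 0" by simp
    moreover have "(\<lambda>\<omega>. indicator D (\<xi> N \<omega> p) :: ennreal) \<in> borel_measurable \<Omega>"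
      using D by (intro measurable_compose[OF xi_gen_measurable[OF True p]]) auto
    ultimately have "AE \<omega> in \<Omega>. indicator D (\<xi> N \<omega> p) = (0::ennreal)" by (subst (asm) nn_integral_0_iff_AE)
    then show ?thesis using AE_space
    proof eventually_elim
      case (elim \<omega>)
      from elim(1) have "\<xi> N \<omega> p \<notin> D" by (auto simp: indicator_def)
      with measurable_space[OF xi_gen_measurable[OF True p] elim(2)] show ?case by (auto simp: D_def)
    qed
  qed simp
  then have "AE \<omega> in \<Omega>. \<forall>N. 1 \<le> qrank \<alpha> N \<longrightarrow> inj_on (\<lambda>i. snd (\<xi> N \<omega> p i)) {..<N}"
    by (subst AE_all_countable) blast
  then show ?thesis
    by eventually_elim (rule eventually_mono[OF eventually_qrank_ge_1[OF \<alpha>]], blast)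
qed

lemma emp_measurable:
  assumes [measurable]: "f \<in> borel_measurable borel"
  shows "(\<lambda>c. emp N c f) \<in> borel_measurable (CM N)"
  unfolding emp_def by measurable

lemma step_mean_measurable:
  assumes [measurable]: "f \<in> borel_measurable borel" and "0 < N"
  shows "(\<lambda>c. step_mean p N c f) \<in> borel_measurable (CM N)"
  unfolding step_mean_def
  by (rule measurable_compose[OF partM_measurable[OF assms(2)] integral_measurable_subprob_algebra]) 
     (rule measurable_compose[OF measurable_fst assms(1)])

lemma emp_init_concentration:
  assumes f[measurable]: "f \<in> borel_measurable borel" and B: "\<And>x. \<bar>f x\<bar> \<le> B" "0 < B" and q: "1 \<le> qrank \<alpha> N" and e: "0 < e"
  shows "O.prob {\<omega> \<in> space \<Omega>. e \<le> \<bar>emp N (\<xi> N \<omega> 0) f - etap \<eta> S \<alpha> 0 f\<bar>} \<le> 2 * exp (- (e\<^sup>2 / (2 * B\<^sup>2)) * real N)"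
proof -
  have N: "0 < N" using q qrank_le[OF \<alpha>(1), of N] by simp
  define D where "D = {c \<in> space (CM N). e \<le> \<bar>emp N c f - etap \<eta> S \<alpha> 0 f\<bar>}"
  note [measurable] = emp_measurable[OF f]
  have D: "D \<in> sets (CM N)" unfolding D_def by measurable
  have m: "(\<lambda>z. f (fst z)) \<in> borel_measurable (\<mu> \<Otimes>\<^sub>M mark)"
    by (intro measurable_compose[OF measurable_fst]) auto
  interpret mk: prob_space mark by (rule prob_space_mark)
  have mean: "(\<integral>z. f (fst z) \<partial>(\<mu> \<Otimes>\<^sub>M mark)) = etap \<eta> S \<alpha> 0 f"
    using integral_distr[of fst "\<mu> \<Otimes>\<^sub>M mark" \<mu> f] mk.distr_pair_fst[of \<mu>] by (simp add: etap_def)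
  have "emeasure \<Omega> {\<omega> \<in> space \<Omega>. e \<le> \<bar>emp N (\<xi> N \<omega> 0) f - etap \<eta> S \<alpha> 0 f\<bar>}
     = emeasure \<Omega> ((\<lambda>\<omega>. \<xi> N \<omega> 0) -` D \<inter> space \<Omega>)"
    using measurable_space[OF xi_gen_measurable[OF q]] by (intro arg_cong[where f="emeasure \<Omega>"]) (auto simp: D_def)
  also have "\<dots> = (\<integral>\<^sup>+\<omega>. indicator D (\<xi> N \<omega> 0) \<partial>\<Omega>)"
    by (rule nn_integral_indicator_vimage[OF xi_gen_measurable[OF q] D, symmetric]) simp
  also have "\<dots> = (\<integral>\<^sup>+\<omega>. indicator D (\<omega> 0) \<partial>T N n)"
    using D by (intro nn_integral_xi[OF q] measurable_compose[OF measurable_gen]) auto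
  also have "\<dots> = (\<integral>\<^sup>+c. indicator D c \<partial>init N)" using D by (intro nn_integral_gen_0) auto
  also have "\<dots> = emeasure (init N) D" using D by simp
  also have "\<dots> = ennreal (measure (init N) D)"
    by (rule finite_measure.emeasure_eq_measure[OF prob_space.finite_measure[OF prob_space_init]])
  also have "measure (init N) D \<le> 2 * exp (- (e\<^sup>2 / (2 * B\<^sup>2)) * real N)"
    using Hoeffding_PiM[OF prob_space_eta_mark m B(1) B(2) e N] unfolding D_def mean space_init emp_def .
  finally show ?thesis by (simp add: O.emeasure_eq_measure ennreal_leI)
qed

text \<open>Given generation \<open>p\<close>, Hoeffding applies to i.i.d. children whose mean is
  \<open>step_mean\<close>. The bound is the same for every configuration with distinct marks, so it
  survives integration over generation \<open>p\<close>.\<close>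

lemma emp_step_concentration:
  assumes f[measurable]: "f \<in> borel_measurable borel" and B: "\<And>x. \<bar>f x\<bar> \<le> B" "0 < B" and q: "1 \<le> qrank \<alpha> N" and e: "0 < e"
    and p: "Suc p \<le> n"
  shows "O.prob {\<omega> \<in> space \<Omega>. e \<le> \<bar>emp N (\<xi> N \<omega> (Suc p)) f - step_mean p N (\<xi> N \<omega> p) f\<bar>} \<le> 2 * exp (- (e\<^sup>2 / (2 * B\<^sup>2)) * real N)"
    (is "_ \<le> ?b")
proof -
  have N: "0 < N" using q qrank_le[OF \<alpha>(1), of N] by simp
  define D where "D = {z \<in> space (CM N \<Otimes>\<^sub>M CM N). e \<le> \<bar>emp N (snd z) f - step_mean p N (fst z) f\<bar>}"
  note [measurable] = emp_measurable[OF f] step_mean_measurable[OF f N]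
  have D: "D \<in> sets (CM N \<Otimes>\<^sub>M CM N)" unfolding D_def by measurable
  have xi: "(\<lambda>\<omega>. (\<xi> N \<omega> p, \<xi> N \<omega> (Suc p))) \<in> \<Omega> \<rightarrow>\<^sub>M CM N \<Otimes>\<^sub>M CM N"
    using p by (intro measurable_Pair xi_gen_measurable q) auto
  have gen: "(\<lambda>\<omega>. (\<omega> p, \<omega> (Suc p))) \<in> PiM {..n} (\<lambda>_. CM N) \<rightarrow>\<^sub>M CM N \<Otimes>\<^sub>M CM N"
    using p by (intro measurable_Pair measurable_gen) auto
  have step: "(\<integral>\<^sup>+c'. indicator D (c, c') \<partial>stepM S K \<alpha> N p c) \<le> ennreal ?b"
    if inj: "inj_on (\<lambda>i. snd (c i)) {..<N}" and c: "c \<in> space (CM N)" for c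
  proof -
    have ne: "surv S \<alpha> N c \<noteq> {}" using card_surv_ge(2)[OF inj q \<alpha>] .
    have m: "(\<lambda>z. f (fst z)) \<in> borel_measurable (partM S K \<alpha> N p c 0)"
      unfolding measurable_cong_sets[OF sets_partM refl] by (rule measurable_compose[OF measurable_fst f])
    have Dc: "Pair c -` D \<in> sets (stepM S K \<alpha> N p c)" using sets_Pair1[OF D] by simp
    have "(\<integral>\<^sup>+c'. indicator D (c, c') \<partial>stepM S K \<alpha> N p c) = emeasure (stepM S K \<alpha> N p c) (Pair c -` D)"
      unfolding nn_integral_indicator[OF Dc, symmetric] by (intro nn_integral_cong) (auto simp: indicator_def)
    also have "\<dots> = ennreal (measure (stepM S K \<alpha> N p c) (Pair c -` D))"
      using prob_space_stepM by (simp add: finite_measure.emeasure_eq_measure prob_space.finite_measure)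
    also have "measure (stepM S K \<alpha> N p c) (Pair c -` D) \<le> ?b"
    proof -
      have "Pair c -` D = {c' \<in> space (stepM S K \<alpha> N p c). e \<le> \<bar>(\<Sum>i<N. f (fst (c' i))) / N - (\<integral>z. f (fst z) \<partial>partM S K \<alpha> N p c 0)\<bar>}"
        using c unfolding D_def emp_def step_mean_def by (auto simp: space_pair_measure)
      then show ?thesis
        using Hoeffding_PiM[OF prob_space_partM m B(1) B(2) e N] stepM_eq_PiM[OF ne, of p] by simp
    qed
    finally show ?thesis by (simp add: ennreal_leI)
  qed
  have "emeasure \<Omega> {\<omega> \<in> space \<Omega>. e \<le> \<bar>emp N (\<xi> N \<omega> (Suc p)) f - step_mean p N (\<xi> N \<omega> p) f\<bar>}
     = emeasure \<Omega> ((\<lambda>\<omega>. (\<xi> N \<omega> p, \<xi> N \<omega> (Suc p))) -` D \<inter> space \<Omega>)"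
    using measurable_space[OF xi] by (intro arg_cong[where f="emeasure \<Omega>"]) (auto simp: D_def)
  also have "\<dots> = (\<integral>\<^sup>+\<omega>. indicator D (\<xi> N \<omega> p, \<xi> N \<omega> (Suc p)) \<partial>\<Omega>)"
    by (rule nn_integral_indicator_vimage[OF xi D, symmetric])
  also have "\<dots> = (\<integral>\<^sup>+\<omega>. indicator D (\<omega> p, \<omega> (Suc p)) \<partial>T N n)"
    using D by (intro nn_integral_xi[OF q] measurable_compose[OF gen]) auto
  also have "\<dots> = (\<integral>\<^sup>+\<omega>. (\<integral>\<^sup>+c'. indicator D (\<omega> p, c') \<partial>stepM S K \<alpha> N p (\<omega> p)) \<partial>T N p)"
    using D by (intro nn_integral_gen_pair[where h="\<lambda>c c'. indicator D (c, c')"] p) auto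
  also have "\<dots> \<le> (\<integral>\<^sup>+\<omega>. ennreal ?b \<partial>T N p)"
  proof (rule nn_integral_mono_AE)
    show "AE \<omega> in T N p. (\<integral>\<^sup>+c'. indicator D (\<omega> p, c') \<partial>stepM S K \<alpha> N p (\<omega> p)) \<le> ennreal ?b"
      using AE_traj_distinct[OF q, of p] AE_space
    proof eventually_elim
      case (elim \<omega>)
      then have "\<omega> p \<in> space (CM N)"
        unfolding space_traj using measurable_space[OF measurable_gen[OF order_refl]] by blast
      with elim(1) show ?case by (rule step)
    qed
  qed
  also have "\<dots> = ennreal ?b"
    using prob_space.emeasure_space_1[OF prob_space_traj[of N p]] by (simp del: space_traj)
  finally show ?thesis by (simp add: O.emeasure_eq_measure)
qed

section \<open>Induction over the generations\<close>

text \<open>The exceptional null set may depend on \<open>f\<close>. All bounded \<open>f\<close>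
  are needed at once because the induction step tests the previous generation with other functions:
  score indicators, the function moved at the limit level, and \<open>wobble\<close>.\<close>

definition LLN :: "nat \<Rightarrow> bool" where
  "LLN p \<longleftrightarrow> (\<forall>f. f \<in> borel_measurable borel \<and> bounded (range f) \<longrightarrow>
     (AE \<omega> in \<Omega>. (\<lambda>N. emp N (\<xi> N \<omega> p) f) \<longlonglongrightarrow> etap \<eta> S \<alpha> p f))"

lemma LLN_D:
  assumes "LLN p" "f \<in> borel_measurable borel" "\<And>x. \<bar>f x\<bar> \<le> B"
  shows "AE \<omega> in \<Omega>. (\<lambda>N. emp N (\<xi> N \<omega> p) f) \<longlonglongrightarrow> etap \<eta> S \<alpha> p f"
proof -
  have "bounded (range f)" using assms(3) by (auto simp: bounded_iff)
  with assms(1,2) show ?thesis unfolding LLN_def by blast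
qed

lemma LLN_0: "LLN 0"
  unfolding LLN_def
proof (intro allI impI, elim conjE)
  fix f :: "'a \<Rightarrow> real" assume f: "f \<in> borel_measurable borel" and "bounded (range f)"
  then obtain B where B: "0 < B" "\<And>x. \<bar>f x\<bar> \<le> B" by (auto simp: bounded_pos)
  have "AE \<omega> in \<Omega>. (\<lambda>N. emp N (\<xi> N \<omega> 0) f - etap \<eta> S \<alpha> 0 f) \<longlonglongrightarrow> 0"
  proof (rule O.AE_tendsto_0_exp_concentration[where C="2 * B\<^sup>2"])
    show "eventually (\<lambda>N. (\<lambda>\<omega>. emp N (\<xi> N \<omega> 0) f - etap \<eta> S \<alpha> 0 f) \<in> borel_measurable \<Omega> \<and>
       (\<forall>e>0. O.prob {\<omega> \<in> space \<Omega>. e \<le> \<bar>emp N (\<xi> N \<omega> 0) f - etap \<eta> S \<alpha> 0 f\<bar>} \<le> 2 * exp (- (e\<^sup>2 / (2 * B\<^sup>2)) * real N))) sequentially"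
      using eventually_qrank_ge_1[OF \<alpha>]
    proof eventually_elim
      case (elim N)
      show ?case
        using emp_init_concentration[OF f B(2,1) elim] measurable_compose[OF xi_gen_measurable[OF elim] emp_measurable[OF f], of 0]
        by (intro conjI allI impI borel_measurable_diff borel_measurable_const) auto
    qed
  qed (use B in auto)
  then show "AE \<omega> in \<Omega>. (\<lambda>N. emp N (\<xi> N \<omega> 0) f) \<longlonglongrightarrow> etap \<eta> S \<alpha> 0 f"
    by eventually_elim (simp add: Lim_null[symmetric])
qed

lemma qlev_AE_tendsto:
  assumes p: "p \<le> n" and "LLN p"
  shows "AE \<omega> in \<Omega>. (\<lambda>N. qlev S \<alpha> N (\<xi> N \<omega> p)) \<longlonglongrightarrow> lev p"
proof -
  have *: "AE \<omega> in \<Omega>. \<forall>k::nat. (\<lambda>N. emp N (\<xi> N \<omega> p) (indicator {x. S x \<le> s k})) \<longlonglongrightarrow> etap \<eta> S \<alpha> p (indicator {x. S x \<le> s k})" for s :: "nat \<Rightarrow> real"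
  proof (subst AE_all_countable, rule allI)
    fix k
    have "(indicator {x. S x \<le> s k} :: 'a \<Rightarrow> real) \<in> borel_measurable borel" by measurable
    then show "AE \<omega> in \<Omega>. (\<lambda>N. emp N (\<xi> N \<omega> p) (indicator {x. S x \<le> s k})) \<longlonglongrightarrow> etap \<eta> S \<alpha> p (indicator {x. S x \<le> s k})"
      by (rule LLN_D[OF assms(2), where B=1]) (simp add: indicator_def)
  qed
  from *[of "\<lambda>k. lev p - 1 / Suc k"] *[of "\<lambda>k. lev p + 1 / Suc k"] AE_xi_distinct[OF p] show ?thesis
  proof eventually_elim
    case (elim \<omega>)
    then show ?case
      using etap_below_lev[OF p] etap_above_lev[OF p]
      by (intro qlev_tendsto[OF elim(3) \<alpha> elim(1)[rule_format] _ elim(2)[rule_format]]) auto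
  qed
qed

lemma LLN_Suc:
  assumes p: "Suc p \<le> n" and IH: "LLN p"
  shows "LLN (Suc p)"
  unfolding LLN_def
proof (intro allI impI, elim conjE)
  fix f :: "'a \<Rightarrow> real" assume f[measurable]: "f \<in> borel_measurable borel" and "bounded (range f)"
  then obtain B where B: "0 < B" "\<And>x. \<bar>f x\<bar> \<le> B" by (auto simp: bounded_pos)
  let ?G = "\<lambda>x. indicator {x. lev p \<le> S x} x * move p (lev p) f x"
  have p': "p \<le> n" using p by simp
  \<comment> \<open>The level in \<open>?G\<close> is the deterministic limit level, so the
    induction hypothesis covers it.\<close>
  have "AE \<omega> in \<Omega>. (\<lambda>N. emp N (\<xi> N \<omega> p) ?G) \<longlonglongrightarrow> etap \<eta> S \<alpha> p ?G"
    using abs_move_le[OF f B(2)] B(1) by (intro LLN_D[OF IH, where B=B]) (auto simp: indicator_def)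
  moreover have "AE \<omega> in \<Omega>. \<forall>k::nat. (\<lambda>N. emp N (\<xi> N \<omega> p) (wobble p B (1 / Suc k))) \<longlonglongrightarrow> etap \<eta> S \<alpha> p (wobble p B (1 / Suc k))"
    using wobble_bounds(2) B(1) by (subst AE_all_countable, intro allI LLN_D[OF IH, where B="4 * B"]) auto
  moreover note qlev_AE_tendsto[OF p' IH] AE_xi_distinct[OF p']
  ultimately have mean: "AE \<omega> in \<Omega>. (\<lambda>N. step_mean p N (\<xi> N \<omega> p) f) \<longlonglongrightarrow> etap \<eta> S \<alpha> (Suc p) f"
    by eventually_elim (rule step_mean_tendsto[OF f B(2)], auto)
  have "AE \<omega> in \<Omega>. (\<lambda>N. emp N (\<xi> N \<omega> (Suc p)) f - step_mean p N (\<xi> N \<omega> p) f) \<longlonglongrightarrow> 0"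
  proof (rule O.AE_tendsto_0_exp_concentration[where C="2 * B\<^sup>2"])
    show "eventually (\<lambda>N. (\<lambda>\<omega>. emp N (\<xi> N \<omega> (Suc p)) f - step_mean p N (\<xi> N \<omega> p) f) \<in> borel_measurable \<Omega> \<and>
       (\<forall>e>0. O.prob {\<omega> \<in> space \<Omega>. e \<le> \<bar>emp N (\<xi> N \<omega> (Suc p)) f - step_mean p N (\<xi> N \<omega> p) f\<bar>} \<le> 2 * exp (- (e\<^sup>2 / (2 * B\<^sup>2)) * real N))) sequentially"
      using eventually_qrank_ge_1[OF \<alpha>]
    proof eventually_elim
      case (elim N)
      have N: "0 < N" using elim qrank_le[OF \<alpha>(1), of N] by simp
      show ?case
        using emp_step_concentration[OF f B(2,1) elim _ p]
          measurable_compose[OF xi_gen_measurable[OF elim p] emp_measurable[OF f]]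
          measurable_compose[OF xi_gen_measurable[OF elim p'] step_mean_measurable[OF f N]]
        by (intro conjI allI impI borel_measurable_diff) auto
    qed
  qed (use B in auto)
  with mean show "AE \<omega> in \<Omega>. (\<lambda>N. emp N (\<xi> N \<omega> (Suc p)) f) \<longlonglongrightarrow> etap \<eta> S \<alpha> (Suc p) f"
  proof eventually_elim
    case (elim \<omega>)
    from tendsto_add[OF elim(2,1)] show ?case by simp
  qed
qed

lemma LLN: "p \<le> n \<Longrightarrow> LLN p"
proof (induction p)
  case (Suc p)
  then show ?case by (intro LLN_Suc) auto
qed (rule LLN_0)

end

section \<open>Convergence in probability\<close>

context splitting_sample
begin

text \<open>Markov's inequality applied to the first-moment bound. The right side is free of
  \<open>N\<close>, which is what truncation requires.\<close>

lemma emp_tail_bound: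
  assumes h[measurable]: "h \<in> borel_measurable borel" and h0: "\<And>x. 0 \<le> h x" and i: "integrable \<mu> h"
    and q: "1 \<le> qrank \<alpha> N" and p: "p \<le> n" and e: "0 < e"
  shows "O.prob {\<omega> \<in> space \<Omega>. e \<le> emp N (\<xi> N \<omega> p) h} \<le> (2 / \<alpha>) ^ p / e * (\<integral>x. h x \<partial>\<mu>)"
proof -
  have N: "0 < N" using q qrank_le[OF \<alpha>(1), of N] by simp
  define u where "u c = (\<Sum>i<N. ennreal (h (fst (c i))))" for c :: "nat \<Rightarrow> 'a \<times> real"
  have u: "u \<in> borel_measurable (CM N)" unfolding u_def by measurable
  have u_eq: "u c = ennreal (real N * emp N c h)" for c
    unfolding u_def emp_def using h0 N by (simp add: sum_ennreal)
  let ?I = "\<integral>x. h x \<partial>\<mu>"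
  have I0: "0 \<le> ?I" using h0 by (intro integral_nonneg_AE) auto
  have ux: "(\<lambda>\<omega>. u (\<xi> N \<omega> p)) \<in> borel_measurable \<Omega>"
    by (rule measurable_compose[OF xi_gen_measurable[OF q p] u])
  have "(\<integral>\<^sup>+\<omega>. u (\<xi> N \<omega> p) \<partial>\<Omega>) = (\<integral>\<^sup>+\<omega>. u (\<omega> p) \<partial>T N n)"
    by (rule nn_integral_xi[OF q measurable_compose[OF measurable_gen[OF p] u]])
  also have "\<dots> = (\<integral>\<^sup>+\<omega>. u (\<omega> p) \<partial>T N p)" by (rule nn_integral_gen[OF p u])
  also have "\<dots> \<le> of_nat N * ennreal ((2 / \<alpha>) ^ p) * (\<integral>\<^sup>+x. ennreal (h x) \<partial>\<mu>)"
    unfolding u_def by (rule nn_integral_gen_le[OF q]) measurable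
  also have "(\<integral>\<^sup>+x. ennreal (h x) \<partial>\<mu>) = ennreal ?I"
    using i h0 by (intro nn_integral_eq_integral) auto
  also have "of_nat N * ennreal ((2 / \<alpha>) ^ p) * ennreal ?I = ennreal (real N * (2 / \<alpha>) ^ p * ?I)"
    using \<alpha> I0 by (simp add: ennreal_of_nat_eq_real_of_nat ennreal_mult)
  finally have E: "(\<integral>\<^sup>+\<omega>. u (\<xi> N \<omega> p) \<partial>\<Omega>) \<le> ennreal (real N * (2 / \<alpha>) ^ p * ?I)" .
  have "1 \<le> ennreal (1 / (real N * e)) * u c \<longleftrightarrow> e \<le> emp N c h" for c
  proof -
    have "0 \<le> emp N c h" unfolding emp_def using h0 by (intro divide_nonneg_nonneg sum_nonneg) auto
    then have "ennreal (1 / (real N * e)) * u c = ennreal (emp N c h / e)"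
      unfolding u_eq using N e by (simp flip: ennreal_mult)
    moreover have "ennreal 1 \<le> ennreal (emp N c h / e) \<longleftrightarrow> 1 \<le> emp N c h / e"
      by (subst ennreal_le_iff2) auto
    ultimately show ?thesis using e by simp
  qed
  then have "emeasure \<Omega> {\<omega> \<in> space \<Omega>. e \<le> emp N (\<xi> N \<omega> p) h}
     = emeasure \<Omega> {\<omega> \<in> space \<Omega>. 1 \<le> ennreal (1 / (real N * e)) * u (\<xi> N \<omega> p)}" by simp
  also have "\<dots> \<le> ennreal (1 / (real N * e)) * (\<integral>\<^sup>+\<omega>. u (\<xi> N \<omega> p) * indicator (space \<Omega>) \<omega> \<partial>\<Omega>)"
    using nn_integral_Markov_inequality[where u="\<lambda>\<omega>. u (\<xi> N \<omega> p)" and M=\<Omega> and A="space \<Omega>" and c="ennreal (1 / (real N * e))"] ux by auto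
  also have "(\<integral>\<^sup>+\<omega>. u (\<xi> N \<omega> p) * indicator (space \<Omega>) \<omega> \<partial>\<Omega>) = (\<integral>\<^sup>+\<omega>. u (\<xi> N \<omega> p) \<partial>\<Omega>)"
    by (intro nn_integral_cong) auto
  also have "ennreal (1 / (real N * e)) * \<dots> \<le> ennreal (1 / (real N * e)) * ennreal (real N * (2 / \<alpha>) ^ p * ?I)"
    by (intro mult_left_mono E) simp
  also have "\<dots> = ennreal (1 / (real N * e) * (real N * (2 / \<alpha>) ^ p * ?I))"
    using N e by (intro ennreal_mult'[symmetric]) auto
  also have "1 / (real N * e) * (real N * (2 / \<alpha>) ^ p * ?I) = (2 / \<alpha>) ^ p / e * ?I"
    using N e by (simp add: field_simps)
  finally show ?thesis using I0 \<alpha> e by (simp add: O.emeasure_eq_measure)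
qed

lemma AE_imp_prob_tendsto:
  fixes X :: "nat \<Rightarrow> 'w \<Rightarrow> real"
  assumes ae: "AE \<omega> in \<Omega>. (\<lambda>N. X N \<omega>) \<longlonglongrightarrow> 0"
    and m: "eventually (\<lambda>N. X N \<in> borel_measurable \<Omega>) sequentially" and e: "0 < e"
  shows "(\<lambda>N. O.prob {\<omega> \<in> space \<Omega>. e < \<bar>X N \<omega>\<bar>}) \<longlonglongrightarrow> 0"
proof -
  \<comment> \<open>The events are emptied for those \<open>N\<close> where measurability may fail,
    so that dominated convergence applies to the whole sequence; the limit does not see the
    change.\<close>
  define A where "A N = (if X N \<in> borel_measurable \<Omega> then {\<omega> \<in> space \<Omega>. e < \<bar>X N \<omega>\<bar>} else {})" for N
  have A: "A N \<in> sets \<Omega>" for N unfolding A_def by auto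
  have "(\<lambda>N. \<integral>\<omega>. indicator (A N) \<omega> \<partial>\<Omega>) \<longlonglongrightarrow> (\<integral>\<omega>. (0::real) \<partial>\<Omega>)"
  proof (rule integral_dominated_convergence[where w="\<lambda>_. 1"])
    show "AE \<omega> in \<Omega>. (\<lambda>N. indicator (A N) \<omega> :: real) \<longlonglongrightarrow> 0"
      using ae
    proof eventually_elim
      case (elim \<omega>)
      then have "eventually (\<lambda>N. dist (X N \<omega>) 0 < e) sequentially" using e by (rule tendstoD)
      then have "eventually (\<lambda>N. indicator (A N) \<omega> = (0::real)) sequentially"
        by eventually_elim (auto simp: A_def indicator_def)
      then show ?case by (rule tendsto_eventually)
    qed
    show "(\<lambda>\<omega>. indicator (A N) \<omega> :: real) \<in> borel_measurable \<Omega>" for N using A by simp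
    show "AE \<omega> in \<Omega>. norm (indicator (A N) \<omega> :: real) \<le> 1" for N by (simp add: indicator_def)
  qed auto
  then have "(\<lambda>N. O.prob (A N)) \<longlonglongrightarrow> 0" using A by (simp add: sets.Int_space_eq2)
  moreover have "eventually (\<lambda>N. O.prob (A N) = O.prob {\<omega> \<in> space \<Omega>. e < \<bar>X N \<omega>\<bar>}) sequentially"
    using m by eventually_elim (simp add: A_def)
  ultimately show ?thesis by (rule Lim_transform_eventually)
qed

text \<open>A three-way split with tolerance e/3 each: the empirical tail, the bounded part
  \<open>g k\<close> governed by the law of large numbers, and the deterministic error in the
  limit.\<close>

lemma emp_prob_tendsto:
  assumes p: "p \<le> n" and f[measurable]: "f \<in> borel_measurable borel" and i: "integrable \<mu> f" and e: "0 < e"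
  shows "(\<lambda>N. O.prob {\<omega> \<in> space \<Omega>. e < \<bar>emp N (\<xi> N \<omega> p) f - etap \<eta> S \<alpha> p f\<bar>}) \<longlonglongrightarrow> 0"
proof -
  define g where "g k x = (if \<bar>f x\<bar> \<le> real k then f x else 0)" for k :: nat and x
  define h where "h k x = (if \<bar>f x\<bar> \<le> real k then 0 else \<bar>f x\<bar>)" for k :: nat and x
  have gm[measurable]: "g k \<in> borel_measurable borel" and hm[measurable]: "h k \<in> borel_measurable borel" for k
    unfolding g_def h_def by measurable
  have h0: "0 \<le> h k x" and gB: "\<bar>g k x\<bar> \<le> real k" and fg: "\<bar>f x - g k x\<bar> = h k x" for k x
    unfolding g_def h_def by auto
  have hi: "integrable \<mu> (h k)" for k
    using i by (rule Bochner_Integration.integrable_bound) (auto simp: h_def)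
  have gi: "integrable \<mu> (g k)" for k
    using i by (rule Bochner_Integration.integrable_bound) (auto simp: g_def)
  have "(\<lambda>k. \<integral>x. h k x \<partial>\<mu>) \<longlonglongrightarrow> (\<integral>x. 0 \<partial>\<mu>)"
  proof (rule integral_dominated_convergence[where w="\<lambda>x. \<bar>f x\<bar>"])
    have "(\<lambda>k. h k x) \<longlonglongrightarrow> 0" for x
    proof (rule tendsto_eventually)
      obtain k0 :: nat where "\<bar>f x\<bar> \<le> real k0" using real_arch_simple by blast
      then show "eventually (\<lambda>k. h k x = 0) sequentially"
        by (intro eventually_sequentiallyI[of k0]) (auto simp: h_def)
    qed
    then show "AE x in \<mu>. (\<lambda>k. h k x) \<longlonglongrightarrow> 0" by simp
  qed (use i in \<open>auto simp: h_def\<close>)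
  then have hlim: "(\<lambda>k. \<integral>x. h k x \<partial>\<mu>) \<longlonglongrightarrow> 0" by simp
  have etap_diff: "\<bar>etap \<eta> S \<alpha> p f - etap \<eta> S \<alpha> p (g k)\<bar> \<le> 1 / \<alpha> ^ p * (\<integral>x. h k x \<partial>\<mu>)" for k
  proof -
    have ind: "integrable \<mu> (\<lambda>x. indicator (region p) x * u x)" if "integrable \<mu> u" for u :: "_ \<Rightarrow> real"
      using integrable_mult_indicator[OF _ that, of "region p"] by simp
    have "etap \<eta> S \<alpha> p f - etap \<eta> S \<alpha> p (g k) = 1 / \<alpha> ^ p * (\<integral>x. indicator (region p) x * f x - indicator (region p) x * g k x \<partial>\<mu>)"
      unfolding etap_eq using ind[OF i] ind[OF gi] by (simp add: right_diff_distrib)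
    moreover have "\<bar>\<integral>x. indicator (region p) x * f x - indicator (region p) x * g k x \<partial>\<mu>\<bar> \<le> (\<integral>x. h k x \<partial>\<mu>)"
    proof (rule order_trans[OF integral_abs_bound], rule integral_mono)
      show "integrable \<mu> (\<lambda>x. \<bar>indicator (region p) x * f x - indicator (region p) x * g k x\<bar>)"
        using ind[OF i] ind[OF gi] by (intro integrable_abs Bochner_Integration.integrable_diff)
      show "\<bar>indicator (region p) x * f x - indicator (region p) x * g k x\<bar> \<le> h k x" for x
        using fg[of x k] h0[of k x] by (cases "x \<in> region p") auto
    qed (rule hi)
    ultimately show ?thesis using \<alpha> by (simp only: abs_mult) (simp add: divide_right_mono)
  qed
  show ?thesis
  proof (rule LIMSEQ_I)
    fix d :: real assume d: "0 < d"
    \<comment> \<open>The first constant controls the deterministic error, the second the Markov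
      bound at threshold e/3. Neither contains \<open>N\<close>, so \<open>k\<close> can be fixed
      before \<open>N\<close> grows.\<close>
    have lims: "(\<lambda>k. 1 / \<alpha> ^ p * (\<integral>x. h k x \<partial>\<mu>)) \<longlonglongrightarrow> 0" "(\<lambda>k. (2 / \<alpha>) ^ p / (e / 3) * (\<integral>x. h k x \<partial>\<mu>)) \<longlonglongrightarrow> 0"
      by (intro tendsto_mult_right_zero hlim)+
    have "eventually (\<lambda>k. 1 / \<alpha> ^ p * (\<integral>x. h k x \<partial>\<mu>) < e / 3) sequentially"
      "eventually (\<lambda>k. (2 / \<alpha>) ^ p / (e / 3) * (\<integral>x. h k x \<partial>\<mu>) < d / 2) sequentially"
      by (rule order_tendstoD(2)[OF lims(1)], use e in simp) (rule order_tendstoD(2)[OF lims(2)], use d in simp)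
    from eventually_conj[OF this] obtain k where
      k: "1 / \<alpha> ^ p * (\<integral>x. h k x \<partial>\<mu>) < e / 3" "(2 / \<alpha>) ^ p / (e / 3) * (\<integral>x. h k x \<partial>\<mu>) < d / 2"
      by (auto simp: eventually_sequentially)
    let ?X = "\<lambda>N \<omega>. emp N (\<xi> N \<omega> p) (g k) - etap \<eta> S \<alpha> p (g k)"
    have Xm: "?X N \<in> borel_measurable \<Omega>" if "1 \<le> qrank \<alpha> N" for N
      by (intro borel_measurable_diff borel_measurable_const measurable_compose[OF xi_gen_measurable[OF that p] emp_measurable] gm)
    have "AE \<omega> in \<Omega>. (\<lambda>N. ?X N \<omega>) \<longlonglongrightarrow> 0"
      using LLN_D[OF LLN[OF p] gm gB] by eventually_elim (rule LIM_zero)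
    then have "(\<lambda>N. O.prob {\<omega> \<in> space \<Omega>. e / 3 < \<bar>?X N \<omega>\<bar>}) \<longlonglongrightarrow> 0"
      using e eventually_mono[OF eventually_qrank_ge_1[OF \<alpha>] Xm] by (intro AE_imp_prob_tendsto) auto
    then have "eventually (\<lambda>N. O.prob {\<omega> \<in> space \<Omega>. e / 3 < \<bar>?X N \<omega>\<bar>} < d / 2) sequentially"
      using d by (intro order_tendstoD(2)) auto
    then have "eventually (\<lambda>N. norm (O.prob {\<omega> \<in> space \<Omega>. e < \<bar>emp N (\<xi> N \<omega> p) f - etap \<eta> S \<alpha> p f\<bar>} - 0) < d) sequentially"
      using eventually_qrank_ge_1[OF \<alpha>]
    proof eventually_elim
      case (elim N)
      let ?A = "{\<omega> \<in> space \<Omega>. e / 3 < \<bar>?X N \<omega>\<bar>}" and ?H = "{\<omega> \<in> space \<Omega>. e / 3 \<le> emp N (\<xi> N \<omega> p) (h k)}"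
      note [measurable] = Xm[OF elim(2)] measurable_compose[OF xi_gen_measurable[OF elim(2) p] emp_measurable[OF hm, of N k]]
      \<comment> \<open>By the triangle inequality a deviation above \<open>e\<close> needs a
        contribution of at least e/3 from one of the two random terms, since the deterministic one
        is below e/3.\<close>
      have sub: "{\<omega> \<in> space \<Omega>. e < \<bar>emp N (\<xi> N \<omega> p) f - etap \<eta> S \<alpha> p f\<bar>} \<subseteq> ?A \<union> ?H"
      proof safe
        fix \<omega> assume *: "e < \<bar>emp N (\<xi> N \<omega> p) f - etap \<eta> S \<alpha> p f\<bar>" "\<not> e / 3 \<le> emp N (\<xi> N \<omega> p) (h k)"
        have "\<bar>\<Sum>i<N. f (fst (\<xi> N \<omega> p i)) - g k (fst (\<xi> N \<omega> p i))\<bar> \<le> (\<Sum>i<N. h k (fst (\<xi> N \<omega> p i)))"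
          by (intro order_trans[OF sum_abs] sum_mono) (simp add: fg)
        then have "\<bar>(\<Sum>i<N. f (fst (\<xi> N \<omega> p i)) - g k (fst (\<xi> N \<omega> p i))) / N\<bar> \<le> (\<Sum>i<N. h k (fst (\<xi> N \<omega> p i))) / N"
          by (simp add: abs_divide divide_right_mono)
        then have "\<bar>emp N (\<xi> N \<omega> p) f - emp N (\<xi> N \<omega> p) (g k)\<bar> \<le> emp N (\<xi> N \<omega> p) (h k)"
          unfolding emp_def by (simp only: sum_subtractf diff_divide_distrib)
        then show "e / 3 < \<bar>?X N \<omega>\<bar>" using * etap_diff[of k] k(1) by linarith
      qed
      have sets: "?A \<in> sets \<Omega>" "?H \<in> sets \<Omega>" by measurable
      have "O.prob {\<omega> \<in> space \<Omega>. e < \<bar>emp N (\<xi> N \<omega> p) f - etap \<eta> S \<alpha> p f\<bar>} \<le> O.prob (?A \<union> ?H)"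
        by (rule O.finite_measure_mono[OF sub sets.Un[OF sets]])
      also have "\<dots> \<le> O.prob ?A + O.prob ?H" by (rule measure_Un_le[OF sets])
      also have "O.prob ?H < d / 2"
        using e by (intro le_less_trans[OF emp_tail_bound[OF hm h0 hi elim(2) p] k(2)]) simp
      finally show ?case using elim(1) by simp
    qed
    then show "\<exists>no. \<forall>N\<ge>no. norm (O.prob {\<omega> \<in> space \<Omega>. e < \<bar>emp N (\<xi> N \<omega> p) f - etap \<eta> S \<alpha> p f\<bar>} - 0) < d"
      by (simp only: eventually_sequentially)
  qed
qed

end

section \<open>The density of the score\<close>

lemma emeasure_density_interval_pos:
  fixes g :: "real \<Rightarrow> real"
  assumes [measurable]: "g \<in> borel_measurable borel" and g: "isCont g l" "0 < g l" and l: "a < b" "a \<le> l" "l \<le> b"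
  shows "0 < emeasure (density lborel (\<lambda>s. ennreal (g s))) {a<..<b}"
proof -
  have "eventually (\<lambda>s. g l / 2 < g s) (nhds l)"
    using g by (intro order_tendstoD(1)[of g "g l"]) (auto simp: isCont_def tendsto_at_iff_tendsto_nhds)
  then obtain d where d: "0 < d" "\<And>s. dist s l < d \<Longrightarrow> g l / 2 < g s"
    by (auto simp: eventually_nhds_metric)
  \<comment> \<open>The part of the open interval within \<open>d\<close> of \<open>l\<close>. It is
    nonempty even when \<open>l\<close> is an endpoint, so one lemma serves both sides of a
    level.\<close>
  define u v where "u = max a (l - d)" and "v = min b (l + d)"
  have uv: "u < v" unfolding u_def v_def using d l by auto
  have "0 < ennreal (g l / 2) * emeasure lborel {u<..<v}"
    using g uv by (simp add: ennreal_zero_less_mult_iff)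
  also have "\<dots> = (\<integral>\<^sup>+s. ennreal (g l / 2) * indicator {u<..<v} s \<partial>lborel)"
    by (simp add: nn_integral_cmult_indicator)
  also have "\<dots> \<le> (\<integral>\<^sup>+s. ennreal (g s) * indicator {a<..<b} s \<partial>lborel)"
  proof (rule nn_integral_mono)
    fix s
    show "ennreal (g l / 2) * indicator {u<..<v} s \<le> ennreal (g s) * indicator {a<..<b} s"
    proof (cases "s \<in> {u<..<v}")
      case True
      then have "dist s l < d" "s \<in> {a<..<b}" unfolding u_def v_def by (auto simp: dist_real_def)
      then show ?thesis using d(2)[of s] True by (simp add: ennreal_leI)
    qed simp
  qed
  also have "\<dots> = emeasure (density lborel (\<lambda>s. ennreal (g s))) {a<..<b}"
    by (subst emeasure_density) auto
  finally show ?thesis .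
qed

theorem theorem1:
  fixes \<eta> :: "'a::euclidean_space \<Rightarrow> real" and S :: "'a \<Rightarrow> real" and fY :: "real \<Rightarrow> real"
    and K :: "nat \<Rightarrow> 'a \<Rightarrow> 'a measure" and \<alpha> Lstar :: real
    and \<Omega> :: "'w measure" and \<xi> :: "nat \<Rightarrow> 'w \<Rightarrow> nat \<Rightarrow> nat \<Rightarrow> 'a \<times> real"
  defines "P \<equiv> measure (etaM \<eta>) {x. Lstar \<le> S x}"
  defines "n \<equiv> nat \<lfloor>ln P / ln \<alpha>\<rfloor>"
  defines "r \<equiv> P / \<alpha> ^ n"
  assumes eta_meas: "\<eta> \<in> borel_measurable borel"
    and eta_nonneg: "\<forall>x. 0 \<le> \<eta> x"
    and eta_prob: "(\<integral>\<^sup>+x. ennreal (\<eta> x) \<partial>lborel) = 1"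
    and S_lip: "\<exists>C. C-lipschitz_on UNIV S"
    and S_grad: "AE x in lborel. \<exists>g. (S has_derivative (\<lambda>h. g \<bullet> h)) (at x) \<and> norm g > 0"
    and fY_meas: "fY \<in> borel_measurable borel"
    and fY_nonneg: "\<forall>s. 0 \<le> fY s"
    and fY_density: "distr (etaM \<eta>) lborel S = density lborel (\<lambda>s. ennreal (fY s))"
    and P_pos: "0 < P"
    and alpha: "0 < \<alpha>" "\<alpha> < 1"
    and r_range: "\<alpha> < r" "r < 1"
    and fY_at_L: "\<forall>p\<le>n. isCont fY (Lq \<eta> S \<alpha> p) \<and> 0 < fY (Lq \<eta> S \<alpha> p)"
    and K_markov: "\<forall>p\<ge>1. K p \<in> borel \<rightarrow>\<^sub>M prob_algebra borel"
    and K_rev: "\<forall>p\<ge>1. \<forall>A\<in>sets borel. \<forall>B\<in>sets borel.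
        (\<integral>\<^sup>+x. indicator A x * emeasure (K p x) B \<partial>etaM \<eta>)
      = (\<integral>\<^sup>+x. indicator B x * emeasure (K p x) A \<partial>etaM \<eta>)"
    and Omega: "prob_space \<Omega>"
    and xi_law: "\<forall>N. 1 \<le> qrank \<alpha> N \<longrightarrow>
        \<xi> N \<in> \<Omega> \<rightarrow>\<^sub>M PiM {..n} (\<lambda>_. CM N)
      \<and> distr \<Omega> (PiM {..n} (\<lambda>_. CM N)) (\<xi> N) = traj \<eta> S K \<alpha> N n"
  shows "(\<forall>p\<le>n. AE \<omega> in \<Omega>. (\<lambda>N. qlev S \<alpha> N (\<xi> N \<omega> p)) \<longlonglongrightarrow> Lq \<eta> S \<alpha> p)
    \<and> (\<forall>p\<le>n. \<forall>f. f \<in> borel_measurable borel \<and> integrable (etaM \<eta>) (\<lambda>x. (f x)\<^sup>2) \<longrightarrow>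
          (\<forall>e>0. (\<lambda>N. measure \<Omega> {\<omega> \<in> space \<Omega>. e < \<bar>emp N (\<xi> N \<omega> p) f - etap \<eta> S \<alpha> p f\<bar>})
                   \<longlonglongrightarrow> 0))
    \<and> (\<forall>p\<le>n. \<forall>f. f \<in> borel_measurable borel \<and> bounded (range f) \<longrightarrow>
          (AE \<omega> in \<Omega>. (\<lambda>N. emp N (\<xi> N \<omega> p) f) \<longlonglongrightarrow> etap \<eta> S \<alpha> p f))"
proof -
  have S: "S \<in> borel_measurable borel"
    using S_lip by (auto intro!: borel_measurable_continuous_onI dest: lipschitz_on_continuous_on)
  have sets: "sets (etaM \<eta>) = sets borel" "space (etaM \<eta>) = UNIV" unfolding etaM_def by auto
  have S': "S \<in> etaM \<eta> \<rightarrow>\<^sub>M lborel" using S by (simp add: measurable_cong_sets[OF sets(1)])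
  have prob: "prob_space (etaM \<eta>)"
    using eta_meas eta_prob by (intro prob_spaceI) (simp add: etaM_def emeasure_density)
  interpret eta: prob_space "etaM \<eta>" by (rule prob)
  have level: "emeasure (etaM \<eta>) {x. S x \<in> A} = emeasure (density lborel (\<lambda>s. ennreal (fY s))) A" if "A \<in> sets borel" for A
    unfolding fY_density[symmetric] using that S' by (subst emeasure_distr) (auto simp: sets vimage_def)
  have atomless: "measure (etaM \<eta>) {x. S x = s} = 0" for s
  proof -
    have "emeasure (density lborel (\<lambda>s. ennreal (fY s))) {s} = (\<integral>\<^sup>+t. ennreal (fY t) * indicator {s} t \<partial>lborel)"
      using fY_meas by (subst emeasure_density) auto
    also have "\<dots> = (\<integral>\<^sup>+(t::real). 0 \<partial>lborel)"
      using AE_lborel_singleton[of s] by (intro nn_integral_cong_AE) (auto elim!: eventually_mono)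
    finally show ?thesis using level[of "{s}"] by (simp add: measure_def)
  qed
  \<comment> \<open>The level may be either endpoint; the two choices give the mass just below and
    just above it.\<close>
  have mass: "0 < measure (etaM \<eta>) {x. a < S x \<and> S x < b}"
    if "p \<le> n" "a < b" "a \<le> Lq \<eta> S \<alpha> p" "Lq \<eta> S \<alpha> p \<le> b" for p a b
  proof -
    have "0 < emeasure (etaM \<eta>) {x. S x \<in> {a<..<b}}"
      using emeasure_density_interval_pos[OF fY_meas _ _ that(2-4)] fY_at_L that(1) by (subst level) auto
    then show ?thesis by (simp add: eta.emeasure_eq_measure)
  qed
  interpret splitting_sample S K \<alpha> \<eta> n \<Omega> \<xi>
  proof (intro splitting_sample.intro splitting_levels.intro splitting.intro particle_kernels.intro
      splitting_axioms.intro splitting_levels_axioms.intro splitting_sample_axioms.intro)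
    show "S \<in> borel_measurable borel" by (rule S)
    show "K (Suc p) \<in> borel \<rightarrow>\<^sub>M prob_algebra borel" for p using K_markov by simp
    show "0 < \<alpha>" "\<alpha> < 1" by (rule alpha)+
    show "\<eta> \<in> borel_measurable borel" by (rule eta_meas)
    show "(\<integral>\<^sup>+x. ennreal (\<eta> x) \<partial>lborel) = 1" by (rule eta_prob)
    show "(\<integral>\<^sup>+x. indicator A x * emeasure (K (Suc p) x) B \<partial>etaM \<eta>)
      = (\<integral>\<^sup>+x. indicator B x * emeasure (K (Suc p) x) A \<partial>etaM \<eta>)"
      if "A \<in> sets borel" "B \<in> sets borel" for p A B using K_rev that by simp
    show "measure (etaM \<eta>) {x. S x = s} = 0" for s by (rule atomless)
    show "0 < measure (etaM \<eta>) {x. a < S x \<and> S x < Lq \<eta> S \<alpha> p}" if "p \<le> n" "a < Lq \<eta> S \<alpha> p" for p a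
      using mass[OF that(1,2)] that by simp
    show "0 < measure (etaM \<eta>) {x. Lq \<eta> S \<alpha> p < S x \<and> S x < b}" if "p \<le> n" "Lq \<eta> S \<alpha> p < b" for p b
      using mass[OF that(1,2)] that by simp
    show "prob_space \<Omega>" by (rule Omega)
    show "\<xi> N \<in> \<Omega> \<rightarrow>\<^sub>M PiM {..n} (\<lambda>_. CM N)" "distr \<Omega> (PiM {..n} (\<lambda>_. CM N)) (\<xi> N) = traj \<eta> S K \<alpha> N n"
      if "1 \<le> qrank \<alpha> N" for N using xi_law that by blast+
  qed
  have L2: "integrable (etaM \<eta>) f"
    if [measurable]: "f \<in> borel_measurable borel" and f: "integrable (etaM \<eta>) (\<lambda>x. (f x)\<^sup>2)" for f :: "'a \<Rightarrow> real"
  proof (rule Bochner_Integration.integrable_bound)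
    show "integrable (etaM \<eta>) (\<lambda>x. 1 + (f x)\<^sup>2)" using f by simp
    show "AE x in etaM \<eta>. norm (f x) \<le> norm (1 + (f x)\<^sup>2)"
    proof (rule AE_I2)
      fix x
      \<comment> \<open>This gives 2|f| \<le> 1 + f^2, and constants are integrable for a
        probability measure.\<close>
      have "0 \<le> (\<bar>f x\<bar> - 1)\<^sup>2" by simp
      also have "(\<bar>f x\<bar> - 1)\<^sup>2 = 1 + (f x)\<^sup>2 - 2 * \<bar>f x\<bar>" by (simp add: power2_diff)
      finally show "norm (f x) \<le> norm (1 + (f x)\<^sup>2)" by simp
    qed
  qed (use that in simp)
  show ?thesis
    using qlev_AE_tendsto LLN emp_prob_tendsto[OF _ _ L2] unfolding LLN_def by blast
qed

end
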